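(* Let $\mathfrak{a}$ be a densely defined, positive definite, closed symmetric sesquilinear form on $\operatorname{Dom}[\mathfrak{a}]$ in a complex Hilbert space $\mathfrak{H}$ with greatest lower bound $\alpha>0$, and let $\mathfrak{v}$ be a symmetric $\mathfrak{a}$-bounded sesquilinear form on $\operatorname{Dom}[\mathfrak{v}]\supset\operatorname{Dom}[\mathfrak{a}]$, that is, $$v=\sup_{0\neq x\in\operatorname{Dom}[\mathfrak{a}]}\frac{|\mathfrak{v}[x]|}{\mathfrak{a}[x]}<\infty.$$ Let $A$ be the uniformly positive self-adjoint operator associated with the closed form $\mathfrak{a}$ and let $J$ be a self-adjoint involution commuting with $A$. Assume, in addition, that $\mathfrak{v}$ is off-diagonal with respect to the orthogonal decomposition $\mathfrak{H}=\mathfrak{H}_+\oplus\mathfrak{H}_-$, $\mathfrak{H}_\pm=\operatorname{Ran}(I\pm J)$, in the sense that $$\mathfrak{v}[Jx,y]=-\mathfrak{v}[x,Jy],\qquad x,y\in\operatorname{Dom}[\mathfrak{a}].$$ On $\operatorname{Dom}[\mathfrak{b}]:=\operatorname{Dom}[\mathfrak{a}]$ introduce the symmetric form $$\mathfrak{b}[x,y]=\mathfrak{a}[x,Jy]+\mathfrak{v}[x,y],\qquad x,y\in\operatorname{Dom}[\mathfrak{b}].$$ Then there is a unique self-adjoint operator $B$ in $\mathfrak{H}$ such that $\operatorname{Dom}(B)\subset\operatorname{Dom}[\mathfrak{b}]$ and $$\mathfrak{b}[x,y]=\langle x,By\rangle\quad\text{for all } x\in\operatorname{Dom}[\mathfrak{b}],\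 y\in\operatorname{Dom}(B).$$ Moreover, the operator $B$ is boundedly invertible and the open interval $(-\alpha,\alpha)$ belongs to its resolvent set.
   Context: Inner products and sesquilinear forms are linear in the second argument and conjugate-linear in the first; $\mathfrak{a}[x]:=\mathfrak{a}[x,x]$ and $\mathfrak{v}[x]:=\mathfrak{v}[x,x]$. The greatest lower bound of $\mathfrak{a}$ is the largest $\alpha$ with $\mathfrak{a}[x]\ge\alpha\|x\|^2$ for all $x\in\operatorname{Dom}[\mathfrak{a}]$. The operator $A$ associated with $\mathfrak{a}$ is the self-adjoint operator given by the classical first representation theorem, so that $\operatorname{Dom}[\mathfrak{a}]=\operatorname{Dom}(A^{1/2})$ and $\mathfrak{a}[x,y]=\langle A^{1/2}x,A^{1/2}y\rangle$. A self-adjoint involution is a bounded operator $J=J^*$ with $J^2=I$; it commutes with $A$ in the sense that it commutes with the spectral projections of $A$ (in particular $J$ maps $\operatorname{Dom}[\mathfrak{a}]$ into itself). *)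

theory Defs
  imports "HOL-Analysis.Analysis"
begin

section \<open>Complex Hilbert spaces\<close>

text \<open>
  The underlying real Hilbert space structure is the library's: the norm and topology are those of
  \<^class>\<open>real_inner\<close>, whose inner product is required to be the real part of the complex one.  Thus
  \<open>norm x = sqrt (Re (cinner x x))\<close>.  The complex inner product is linear in the second
  and conjugate-linear in the first argument.
\<close>

class complex_hilbert = real_inner + complete_space +
  fixes scaleC :: "complex \<Rightarrow> 'a \<Rightarrow> 'a"  (infixr "*\<^sub>C" 75)
    and cinner :: "'a \<Rightarrow> 'a \<Rightarrow> complex"
  assumes scaleC_add_right: "c *\<^sub>C (x + y) = c *\<^sub>C x + c *\<^sub>C y"
    and scaleC_add_left: "(c + d) *\<^sub>C x = c *\<^sub>C x + d *\<^sub>C x"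
    and scaleC_scaleC: "c *\<^sub>C d *\<^sub>C x = (c * d) *\<^sub>C x"
    and scaleR_scaleC: "scaleR r x = complex_of_real r *\<^sub>C x"
    and cinner_commute: "cinner x y = cnj (cinner y x)"
    and cinner_add_right: "cinner x (y + z) = cinner x y + cinner x z"
    and cinner_scaleC_right: "cinner x (c *\<^sub>C y) = c * cinner x y"
    and inner_eq_Re_cinner: "inner x y = Re (cinner x y)"

instantiation complex :: complex_hilbert
begin

definition scaleC_complex :: "complex \<Rightarrow> complex \<Rightarrow> complex"
  where "scaleC_complex c x = c * x"

definition cinner_complex :: "complex \<Rightarrow> complex \<Rightarrow> complex"
  where "cinner_complex x y = cnj x * y"

instance
  by standard
    (auto simp: scaleC_complex_def cinner_complex_def inner_complex_def algebra_simps
      scaleR_conv_of_real)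

end

definition csubspace :: "'h::complex_hilbert set \<Rightarrow> bool" where
  "csubspace D \<longleftrightarrow>
     0 \<in> D \<and> (\<forall>x\<in>D. \<forall>y\<in>D. x + y \<in> D) \<and> (\<forall>c. \<forall>x\<in>D. c *\<^sub>C x \<in> D)"

definition bounded_clinear :: "('h::complex_hilbert \<Rightarrow> 'h) \<Rightarrow> bool" where
  "bounded_clinear T \<longleftrightarrow> bounded_linear T \<and> (\<forall>c x. T (c *\<^sub>C x) = c *\<^sub>C T x)"

definition bounded_self_adjoint :: "('h::complex_hilbert \<Rightarrow> 'h) \<Rightarrow> bool" where
  "bounded_self_adjoint T \<longleftrightarrow>
     bounded_clinear T \<and> (\<forall>x y. cinner (T x) y = cinner x (T y))"

definition self_adjoint_involution :: "('h::complex_hilbert \<Rightarrow> 'h) \<Rightarrow> bool" where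
  "self_adjoint_involution J \<longleftrightarrow> bounded_self_adjoint J \<and> (\<forall>x. J (J x) = x)"

definition orthogonal_projection :: "('h::complex_hilbert \<Rightarrow> 'h) \<Rightarrow> bool" where
  "orthogonal_projection P \<longleftrightarrow> bounded_self_adjoint P \<and> (\<forall>x. P (P x) = P x)"


section \<open>Unbounded operators\<close>

text \<open>
  A (possibly unbounded) operator in \<open>'h\<close> is a partial function, so that its domain is
  \<^term>\<open>dom T\<close> and equality of operators is equality of domains and of values.
\<close>

type_synonym 'h oper = "'h \<rightharpoonup> 'h"

definition app :: "'h oper \<Rightarrow> 'h \<Rightarrow> 'h" where
  "app T x = the (T x)"

definition linear_operator :: "'h::complex_hilbert oper \<Rightarrow> bool" where
  "linear_operator T \<longleftrightarrow>
     csubspace (dom T) \<and>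
     (\<forall>x\<in>dom T. \<forall>y\<in>dom T. app T (x + y) = app T x + app T y) \<and>
     (\<forall>c. \<forall>x\<in>dom T. app T (c *\<^sub>C x) = c *\<^sub>C app T x)"

text \<open>The vector \<open>z\<close> below is unique only if \<^term>\<open>T\<close> is densely defined.\<close>

definition adjoint_operator :: "'h::complex_hilbert oper \<Rightarrow> 'h oper" where
  "adjoint_operator T = (\<lambda>y.
     if \<exists>z. \<forall>x\<in>dom T. cinner (app T x) y = cinner x z
     then Some (THE z. \<forall>x\<in>dom T. cinner (app T x) y = cinner x z)
     else None)"

definition self_adjoint :: "'h::complex_hilbert oper \<Rightarrow> bool" where
  "self_adjoint T \<longleftrightarrow>
     linear_operator T \<and> closure (dom T) = UNIV \<and> adjoint_operator T = T"

definition boundedly_invertible :: "'h::complex_hilbert oper \<Rightarrow> bool" where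
  "boundedly_invertible T \<longleftrightarrow>
     (\<exists>S. bounded_clinear S \<and>
          (\<forall>y. S y \<in> dom T \<and> app T (S y) = y) \<and> (\<forall>x\<in>dom T. S (app T x) = x))"

definition shift_operator :: "'h::complex_hilbert oper \<Rightarrow> complex \<Rightarrow> 'h oper" where
  "shift_operator T \<zeta> = (\<lambda>x. map_option (\<lambda>y. y - \<zeta> *\<^sub>C x) (T x))"

definition resolvent_set :: "'h::complex_hilbert oper \<Rightarrow> complex set" where
  "resolvent_set T = {\<zeta>. boundedly_invertible (shift_operator T \<zeta>)}"


section \<open>Spectral projections\<close>

definition projection_valued_measure ::
    "(real set \<Rightarrow> 'h::complex_hilbert \<Rightarrow> 'h) \<Rightarrow> bool" where
  "projection_valued_measure E \<longleftrightarrow>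
     (\<forall>S\<in>sets borel. orthogonal_projection (E S)) \<and>
     (\<forall>x. E UNIV x = x) \<and>
     (\<forall>F :: nat \<Rightarrow> real set. range F \<subseteq> sets borel \<longrightarrow> disjoint_family F \<longrightarrow>
        (\<forall>x. (\<lambda>n. E (F n) x) sums E (\<Union>n. F n) x))"

text \<open>The scalar measure \<open>S \<mapsto> \<langle>x, E(S) x\<rangle>\<close> on the Borel sets of the real line.\<close>

definition scalar_spectral_measure ::
    "(real set \<Rightarrow> 'h::complex_hilbert \<Rightarrow> 'h) \<Rightarrow> 'h \<Rightarrow> real measure" where
  "scalar_spectral_measure E x =
     measure_of UNIV (sets borel) (\<lambda>S. ennreal (Re (cinner x (E S x))))"

text \<open>
  \<open>A = \<integral> t dE(t)\<close>, understood as usual: the domain of \<open>A\<close> consists of the vectors \<open>x\<close> with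
  \<open>\<integral> t\<^sup>2 d\<langle>x, E(t) x\<rangle> < \<infinity>\<close>, and for these \<open>\<langle>x, A x\<rangle> = \<integral> t d\<langle>x, E(t) x\<rangle>\<close> (by polarization, this
  fixes \<open>\<langle>x, A y\<rangle>\<close> for all \<open>x\<close> and \<open>y\<close> in the domain).
\<close>

definition spectral_measure_of ::
    "'h::complex_hilbert oper \<Rightarrow> (real set \<Rightarrow> 'h \<Rightarrow> 'h) \<Rightarrow> bool" where
  "spectral_measure_of A E \<longleftrightarrow>
     projection_valued_measure E \<and>
     dom A = {x. integrable (scalar_spectral_measure E x) (\<lambda>t. t\<^sup>2)} \<and>
     (\<forall>x\<in>dom A.
        cinner x (app A x) = complex_of_real (\<integral>t. t \<partial>scalar_spectral_measure E x))"

text \<open>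
  For self-adjoint \<open>A\<close>, the spectral theorem says that there is exactly one \<open>E\<close> as below (up to its
  irrelevant values on non-Borel sets), so the existential quantifier merely names it.
\<close>

definition commutes_with_operator ::
    "('h::complex_hilbert \<Rightarrow> 'h) \<Rightarrow> 'h oper \<Rightarrow> bool" where
  "commutes_with_operator J A \<longleftrightarrow>
     (\<exists>E. spectral_measure_of A E \<and> (\<forall>S\<in>sets borel. \<forall>x. J (E S x) = E S (J x)))"


section \<open>Sesquilinear forms\<close>

text \<open>
  A form is given by its domain \<open>D\<close> and a function \<open>a\<close> whose values outside \<open>D \<times> D\<close> are
  irrelevant.  The value \<open>a x x\<close> of a symmetric form is real, whence the \<^const>\<open>Re\<close> below.
\<close>

type_synonym 'h form = "'h \<Rightarrow> 'h \<Rightarrow> complex"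

definition sesquilinear_form :: "'h::complex_hilbert set \<Rightarrow> 'h form \<Rightarrow> bool" where
  "sesquilinear_form D a \<longleftrightarrow>
     csubspace D \<and>
     (\<forall>x\<in>D. \<forall>y\<in>D. \<forall>z\<in>D. a x (y + z) = a x y + a x z \<and> a (x + y) z = a x z + a y z) \<and>
     (\<forall>c. \<forall>x\<in>D. \<forall>y\<in>D. a x (c *\<^sub>C y) = c * a x y \<and> a (c *\<^sub>C x) y = cnj c * a x y)"

definition symmetric_form :: "'h::complex_hilbert set \<Rightarrow> 'h form \<Rightarrow> bool" where
  "symmetric_form D a \<longleftrightarrow>
     sesquilinear_form D a \<and> (\<forall>x\<in>D. \<forall>y\<in>D. a x y = cnj (a y x))"

definition positive_definite_form :: "'h::complex_hilbert set \<Rightarrow> 'h form \<Rightarrow> bool" where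
  "positive_definite_form D a \<longleftrightarrow> (\<forall>x\<in>D. x \<noteq> 0 \<longrightarrow> Re (a x x) > 0)"

definition closed_form :: "'h::complex_hilbert set \<Rightarrow> 'h form \<Rightarrow> bool" where
  "closed_form D a \<longleftrightarrow>
     (\<forall>X x. (\<forall>n. X n \<in> D) \<longrightarrow> X \<longlonglongrightarrow> x \<longrightarrow>
        (\<forall>e>0. \<exists>N::nat. \<forall>m\<ge>N. \<forall>n\<ge>N. cmod (a (X m - X n) (X m - X n)) < e) \<longrightarrow>
        x \<in> D \<and> (\<lambda>n. a (X n - x) (X n - x)) \<longlonglongrightarrow> 0)"

definition form_lower_bound :: "'h::complex_hilbert set \<Rightarrow> 'h form \<Rightarrow> real \<Rightarrow> bool" where
  "form_lower_bound D a \<alpha> \<longleftrightarrow> (\<forall>x\<in>D. Re (a x x) \<ge> \<alpha> * (norm x)\<^sup>2)"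

definition form_greatest_lower_bound ::
    "'h::complex_hilbert set \<Rightarrow> 'h form \<Rightarrow> real \<Rightarrow> bool" where
  "form_greatest_lower_bound D a \<alpha> \<longleftrightarrow>
     form_lower_bound D a \<alpha> \<and> (\<forall>\<beta>. form_lower_bound D a \<beta> \<longrightarrow> \<beta> \<le> \<alpha>)"

definition relative_form_bound ::
    "'h::complex_hilbert set \<Rightarrow> 'h form \<Rightarrow> 'h form \<Rightarrow> ereal" where
  "relative_form_bound D a v = (SUP x\<in>D - {0}. ereal (cmod (v x x) / Re (a x x)))"

text \<open>
  For densely defined closed symmetric forms \<open>a\<close> that are bounded below, the first representation
  theorem says that there is exactly one \<open>T\<close> with the following property, the operator associated
  with \<open>a\<close>.  For indefinite forms the notion is the same, but existence and uniqueness may fail.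
\<close>

definition associated_operator ::
    "'h::complex_hilbert set \<Rightarrow> 'h form \<Rightarrow> 'h oper \<Rightarrow> bool" where
  "associated_operator D a T \<longleftrightarrow>
     self_adjoint T \<and> dom T \<subseteq> D \<and> (\<forall>x\<in>D. \<forall>y\<in>dom T. a x y = cinner x (app T y))"

end

theory Submission
  imports Defs
begin

text \<open>
  On \<open>D = Dom[a]\<close>, normed by \<open>a\<close>, the involution \<open>J\<close> is unitary: it preserves \<open>\<langle>x, A x\<rangle>\<close> on \<open>Dom(A)\<close>, as
  \<open>x\<close> and \<open>J x\<close> have the same scalar spectral measure, and \<open>Dom(A)\<close> is a form core. Off-diagonality
  makes \<open>v[J x, x]\<close> purely imaginary, so \<open>Re b[J x, x] = a[x]\<close>. For real \<open>\<lambda>\<close> with \<open>\<bar>\<lambda>\<bar> < \<alpha>\<close> the form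
  \<open>b[J x, y] - \<lambda> \<langle>J x, y\<rangle>\<close> is therefore coercive with constant \<open>1 - \<bar>\<lambda>\<bar> / \<alpha>\<close>, and the Lax-Milgram
  theorem yields the resolvent \<open>(B - \<lambda>)\<inverse>\<close> as a bounded operator. At \<open>\<lambda> = 0\<close> it is symmetric and
  injective, and \<open>B\<close> is its inverse.
\<close>

section \<open>Complete symmetric forms on real vector spaces\<close>

text \<open>Complex forms enter through their real parts. Nothing is lost: the imaginary part is the
  real part at \<open>\<i> *\<^sub>C x\<close>. Symmetry is left out because the coercive form fed
  to Lax-Milgram lacks it in general.\<close>

definition bilinear_on :: "'a::real_vector set \<Rightarrow> ('a \<Rightarrow> 'a \<Rightarrow> real) \<Rightarrow> bool" where
  "bilinear_on D c \<longleftrightarrow>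
     subspace D \<and>
     (\<forall>x\<in>D. \<forall>y\<in>D. \<forall>z\<in>D. c (x + y) z = c x z + c y z \<and> c x (y + z) = c x y + c x z) \<and>
     (\<forall>r. \<forall>x\<in>D. \<forall>y\<in>D. c (r *\<^sub>R x) y = r * c x y \<and> c x (r *\<^sub>R y) = r * c x y)"

context
  fixes D :: "'a::real_vector set" and c
  assumes c: "bilinear_on D c"
begin

lemma bilinear_on_subspace: "subspace D"
  using c unfolding bilinear_on_def by blast

lemma bilinear_on_add_left: "\<lbrakk>x \<in> D; y \<in> D; z \<in> D\<rbrakk> \<Longrightarrow> c (x + y) z = c x z + c y z"
  and bilinear_on_add_right: "\<lbrakk>x \<in> D; y \<in> D; z \<in> D\<rbrakk> \<Longrightarrow> c x (y + z) = c x y + c x z"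
  and bilinear_on_scale_left: "\<lbrakk>x \<in> D; y \<in> D\<rbrakk> \<Longrightarrow> c (r *\<^sub>R x) y = r * c x y"
  and bilinear_on_scale_right: "\<lbrakk>x \<in> D; y \<in> D\<rbrakk> \<Longrightarrow> c x (r *\<^sub>R y) = r * c x y"
  using c unfolding bilinear_on_def by blast+

lemma bilinear_on_diff_left: "\<lbrakk>x \<in> D; y \<in> D; z \<in> D\<rbrakk> \<Longrightarrow> c (x - y) z = c x z - c y z"
  using bilinear_on_add_left[of x "(-1) *\<^sub>R y" z] bilinear_on_scale_left[of y z "-1"]
    subspace_scale[OF bilinear_on_subspace, of y "-1"] by simp

lemma bilinear_on_diff_right: "\<lbrakk>x \<in> D; y \<in> D; z \<in> D\<rbrakk> \<Longrightarrow> c x (y - z) = c x y - c x z"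
  using bilinear_on_add_right[of x y "(-1) *\<^sub>R z"] bilinear_on_scale_right[of x z "-1"]
    subspace_scale[OF bilinear_on_subspace, of z "-1"] by simp

lemma bilinear_on_zero_left: "x \<in> D \<Longrightarrow> c 0 x = 0"
  using bilinear_on_scale_left[of x x 0] by simp

lemmas bilinear_on_simps = bilinear_on_add_left bilinear_on_add_right bilinear_on_scale_left
  bilinear_on_scale_right bilinear_on_diff_left bilinear_on_diff_right

end

text \<open>A real Hilbert space carried by a subspace instead of a type, so that the form domain
  with \<open>a\<close> and the whole space with \<open>inner\<close> are both instances.
  Completeness refers to the form norm only.\<close>

locale complete_real_form =
  fixes D :: "'a::real_vector set" and a :: "'a \<Rightarrow> 'a \<Rightarrow> real"
  assumes bilin: "bilinear_on D a"
    and sym: "\<lbrakk>x \<in> D; y \<in> D\<rbrakk> \<Longrightarrow> a x y = a y x"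
    and pos: "\<lbrakk>x \<in> D; x \<noteq> 0\<rbrakk> \<Longrightarrow> a x x > 0"
    and complete: "\<lbrakk>\<And>n. X n \<in> D; \<And>e. e > 0 \<Longrightarrow> \<exists>N::nat. \<forall>m\<ge>N. \<forall>n\<ge>N. a (X m - X n) (X m - X n) < e\<rbrakk>
      \<Longrightarrow> \<exists>x\<in>D. (\<lambda>n. a (X n - x) (X n - x)) \<longlonglongrightarrow> 0"
begin

lemmas sub = bilinear_on_subspace[OF bilin]
lemmas in_D = subspace_add[OF sub] subspace_diff[OF sub] subspace_scale[OF sub] subspace_0[OF sub]
lemmas a_simps = bilinear_on_simps[OF bilin] bilinear_on_zero_left[OF bilin]

lemma nonneg: "x \<in> D \<Longrightarrow> a x x \<ge> 0"
  using pos[of x] bilinear_on_zero_left[OF bilin in_D(4)] by (cases "x = 0") auto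

lemma eq_zero: "\<lbrakk>x \<in> D; a x x \<le> 0\<rbrakk> \<Longrightarrow> x = 0"
  using pos[of x] by (cases "x = 0") auto

section \<open>The form norm, Cauchy-Schwarz and continuity of the form\<close>

definition fnorm :: "'a \<Rightarrow> real" where "fnorm x = sqrt (a x x)"

lemma fnorm_nonneg: "x \<in> D \<Longrightarrow> fnorm x \<ge> 0"
  by (simp add: fnorm_def nonneg)

lemma fnorm_square: "x \<in> D \<Longrightarrow> (fnorm x)\<^sup>2 = a x x"
  by (simp add: fnorm_def nonneg)

text \<open>Scaling \<open>x\<close> by the norm of \<open>y\<close> and vice versa balances the two
  terms of the hypothesis and turns the sum into a product. Cauchy-Schwarz and the bound on
  \<open>v\<close> both come from this.\<close>

lemma bounded_bilinear_on:
  assumes c: "bilinear_on D c" and K: "\<And>x y. \<lbrakk>x \<in> D; y \<in> D\<rbrakk> \<Longrightarrow> 2 * c x y \<le> K * (a x x + a y y)"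
    and x: "x \<in> D" and y: "y \<in> D"
  shows "\<bar>c x y\<bar> \<le> K * fnorm x * fnorm y"
proof (cases "x = 0 \<or> y = 0")
  case True
  then have "c x y = 0"
    using bilinear_on_scale_left[OF c, of x y 0] bilinear_on_scale_right[OF c, of x y 0] x y by auto
  moreover have "a 0 0 = 0" using bilinear_on_zero_left[OF bilin in_D(4)] .
  ultimately show ?thesis using True by (auto simp: fnorm_def)
next
  case False
  define s t where "s = fnorm x" and "t = fnorm y"
  have s: "s > 0" and t: "t > 0" using pos x y False by (auto simp: s_def t_def fnorm_def)
  have s2: "a x x = s\<^sup>2" and t2: "a y y = t\<^sup>2" using fnorm_square x y by (auto simp: s_def t_def)
  \<comment> \<open>The sign \<open>r\<close> covers both halves of the absolute value at
    once.\<close>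
  have *: "r * c x y \<le> K * (s * t)" if r: "\<bar>r\<bar> = 1" for r
  proof -
    have "r * r = 1" using r by (metis abs_mult_self_eq mult.right_neutral)
    have "2 * c ((r * t) *\<^sub>R x) (s *\<^sub>R y)
        \<le> K * (a ((r * t) *\<^sub>R x) ((r * t) *\<^sub>R x) + a (s *\<^sub>R y) (s *\<^sub>R y))"
      by (rule K) (use x y in_D in auto)
    also have "c ((r * t) *\<^sub>R x) (s *\<^sub>R y) = r * t * (s * c x y)"
      using x y in_D by (simp add: bilinear_on_simps[OF c])
    also have "a ((r * t) *\<^sub>R x) ((r * t) *\<^sub>R x) = (r * r) * t\<^sup>2 * s\<^sup>2"
      using x in_D s2 by (simp add: a_simps power2_eq_square)
    also have "a (s *\<^sub>R y) (s *\<^sub>R y) = s\<^sup>2 * t\<^sup>2"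
      using y in_D t2 by (simp add: a_simps power2_eq_square)
    finally have "(s * t) * (r * c x y) \<le> (s * t) * (K * (s * t))"
      using \<open>r * r = 1\<close> by (simp add: algebra_simps power2_eq_square)
    then show ?thesis using s t by simp
  qed
  from *[of 1] *[of "-1"] show ?thesis by (simp add: s_def t_def abs_le_iff algebra_simps)
qed

lemma Cauchy_Schwarz:
  assumes x: "x \<in> D" and y: "y \<in> D"
  shows "\<bar>a x y\<bar> \<le> fnorm x * fnorm y"
proof -
  \<comment> \<open>Expand \<open>a (x - y) (x - y) \<ge> 0\<close>.\<close>
  have "2 * a x y \<le> 1 * (a x x + a y y)" if "x \<in> D" "y \<in> D" for x y
    using nonneg[of "x - y"] that in_D by (simp add: a_simps sym[of y x])
  from bounded_bilinear_on[OF bilin this x y] show ?thesis by simp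
qed

lemma fnorm_triangle:
  assumes x: "x \<in> D" and y: "y \<in> D"
  shows "fnorm (x + y) \<le> fnorm x + fnorm y"
proof (rule power2_le_imp_le)
  have "(fnorm (x + y))\<^sup>2 = a x x + 2 * a x y + a y y"
    using x y in_D by (simp add: fnorm_square a_simps sym[of y x])
  also have "\<dots> \<le> (fnorm x + fnorm y)\<^sup>2"
    using Cauchy_Schwarz[OF x y] x y by (simp add: power2_sum fnorm_square)
  finally show "(fnorm (x + y))\<^sup>2 \<le> (fnorm x + fnorm y)\<^sup>2" .
qed (use fnorm_nonneg x y in auto)

lemma tendsto_form:
  assumes X: "\<And>n. X n \<in> D" and x: "x \<in> D" and lim: "(\<lambda>n. a (X n - x) (X n - x)) \<longlonglongrightarrow> 0"
  shows "y \<in> D \<Longrightarrow> (\<lambda>n. a (X n) y) \<longlonglongrightarrow> a x y"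
    and "(\<lambda>n. a (X n) (X n)) \<longlonglongrightarrow> a x x"
proof -
  have n0: "(\<lambda>n. fnorm (X n - x)) \<longlonglongrightarrow> 0"
    using tendsto_real_sqrt[OF lim] by (simp add: fnorm_def)
  show *: "(\<lambda>n. a (X n) y) \<longlonglongrightarrow> a x y" if y: "y \<in> D" for y
  proof (rule LIM_zero_cancel, rule Lim_null_comparison[where g = "\<lambda>n. fnorm (X n - x) * fnorm y"])
    show "\<forall>\<^sub>F n in sequentially. norm (a (X n) y - a x y) \<le> fnorm (X n - x) * fnorm y"
      using Cauchy_Schwarz[of "X n - x" y for n] X x y in_D by (auto simp: a_simps)
    show "(\<lambda>n. fnorm (X n - x) * fnorm y) \<longlonglongrightarrow> 0"
      using tendsto_mult_right[OF n0] by simp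
  qed
  have "(\<lambda>n. a (X n - x) (X n - x) + 2 * a (X n) x - a x x) \<longlonglongrightarrow> 0 + 2 * a x x - a x x"
    by (intro tendsto_intros lim * x)
  moreover have "a (X n - x) (X n - x) + 2 * a (X n) x - a x x = a (X n) (X n)" for n
    using X[of n] x in_D by (simp add: a_simps sym[OF x X])
  ultimately show "(\<lambda>n. a (X n) (X n)) \<longlonglongrightarrow> a x x" by simp
qed

text \<open>
  If \<open>S\<close> is not closed, the representing vector lies only in its closure for the form norm. The
  approximating sequence makes the lemma double as a density criterion.
\<close>

lemma Riesz_on_subspace:
  assumes S: "subspace S" "S \<subseteq> D"
    and add: "\<And>x y. \<lbrakk>x \<in> S; y \<in> S\<rbrakk> \<Longrightarrow> l (x + y) = l x + l y"
    and scale: "\<And>r x. x \<in> S \<Longrightarrow> l (r *\<^sub>R x) = r * l x"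
    and bound: "\<And>x. x \<in> S \<Longrightarrow> \<bar>l x\<bar> \<le> K * fnorm x"
  obtains z X where "z \<in> D" "\<And>y. y \<in> S \<Longrightarrow> a z y = l y"
    "\<And>n::nat. X n \<in> S" "(\<lambda>n. a (X n - z) (X n - z)) \<longlonglongrightarrow> 0"
proof -
  \<comment> \<open>A minimiser of this energy has \<open>a z y = l y\<close> as its Euler
    equation.\<close>
  define F where "F x = a x x - 2 * l x" for x
  define \<mu> where "\<mu> = Inf (F ` S)"
  \<comment> \<open>Completing the square in \<open>fnorm x\<close> bounds the energy from
    below.\<close>
  have "F x \<ge> - K\<^sup>2" if "x \<in> S" for x
  proof -
    have "x \<in> D" using that S by blast
    have "0 \<le> (fnorm x - K)\<^sup>2" by simp
    also have "\<dots> = a x x - 2 * (K * fnorm x) + K\<^sup>2"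
      using \<open>x \<in> D\<close> by (simp add: power2_diff fnorm_square)
    finally show ?thesis using bound[OF that] unfolding F_def by linarith
  qed
  then have bdd: "bdd_below (F ` S)" by (intro bdd_belowI2)
  have \<mu>_le: "\<mu> \<le> F x" if "x \<in> S" for x
    unfolding \<mu>_def using bdd that by (simp add: cInf_lower)
  have "\<exists>x\<in>S. F x < \<mu> + inverse (real (Suc n))" for n
  proof -
    have "F ` S \<noteq> {}" using subspace_0[OF S(1)] by blast
    moreover have "Inf (F ` S) < \<mu> + inverse (real (Suc n))" unfolding \<mu>_def by simp
    ultimately show ?thesis using cInf_lessD[of "F ` S"] by auto
  qed
  then obtain X where XS: "\<And>n. X n \<in> S" and X: "\<And>n. F (X n) < \<mu> + inverse (real (Suc n))"
    by metis
  have XD: "X n \<in> D" for n using XS S by blast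
  \<comment> \<open>Parallelogram law: the midpoint \<open>?h\<close> stays in \<open>S\<close>, so
    its energy is at least \<open>\<mu>\<close>, and near-minimisers are close in the form
    norm.\<close>
  have close: "a (X m - X n) (X m - X n) \<le> 2 * inverse (real (Suc m)) + 2 * inverse (real (Suc n))"
    for m n
  proof -
    let ?h = "(1/2) *\<^sub>R (X m + X n)"
    have h: "?h \<in> S" by (intro subspace_scale[OF S(1)] subspace_add[OF S(1)] XS)
    have s: "X m + X n \<in> S" "X m + X n \<in> D" using subspace_add[OF S(1)] XS S(2) by blast+
    have "a ?h ?h = (1/4) * a (X m + X n) (X m + X n)"
      using a_simps(3)[OF s(2) in_D(3)[OF s(2)]] a_simps(4)[OF s(2) s(2)] by simp
    moreover have "l ?h = (1/2) * (l (X m) + l (X n))"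
      using scale[OF s(1), of "1/2"] add[OF XS XS] by simp
    moreover have "a (X m + X n) (X m + X n) + a (X m - X n) (X m - X n)
        = 2 * a (X m) (X m) + 2 * a (X n) (X n)"
      using XD[of m] XD[of n] in_D by (simp add: a_simps)
    ultimately have "a (X m - X n) (X m - X n) = 2 * F (X m) + 2 * F (X n) - 4 * F ?h"
      unfolding F_def by simp
    also have "\<dots> \<le> 2 * F (X m) + 2 * F (X n) - 4 * \<mu>" using \<mu>_le[OF h] by simp
    finally show ?thesis using X[of m] X[of n] by linarith
  qed
  have "\<exists>N. \<forall>m\<ge>N. \<forall>n\<ge>N. a (X m - X n) (X m - X n) < e" if "e > 0" for e
  proof -
    obtain N where N: "inverse (real (Suc N)) < e / 4"
      using reals_Archimedean[of "e / 4"] \<open>e > 0\<close> by (metis divide_pos_pos zero_less_numeral)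
    have le: "inverse (real (Suc n)) \<le> inverse (real (Suc N))" if "n \<ge> N" for n
      using that by (intro le_imp_inverse_le) simp_all
    have "a (X m - X n) (X m - X n) < e" if "m \<ge> N" "n \<ge> N" for m n
      using close[of m n] le[OF that(1)] le[OF that(2)] N by linarith
    then show ?thesis by blast
  qed
  from complete[OF XD this] obtain z where z: "z \<in> D" and lim: "(\<lambda>n. a (X n - z) (X n - z)) \<longlonglongrightarrow> 0"
    by blast
  have "a z y = l y" if y: "y \<in> S" for y
  proof -
    have yD: "y \<in> D" using y S by blast
    define p where "p = a z y - l y"
    \<comment> \<open>Compare the near-minimiser \<open>X n\<close> with
      \<open>X n + t *\<^sub>R y\<close>; the defect \<open>1 / (n + 1)\<close> disappears in the
      limit.\<close>
    have ineq: "0 \<le> 2 * t * p + t\<^sup>2 * a y y" for t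
    proof -
      have "\<mu> \<le> F (X n + t *\<^sub>R y)" for n
        by (intro \<mu>_le subspace_add[OF S(1)] subspace_scale[OF S(1)] XS y)
      also have "F (X n + t *\<^sub>R y) = F (X n) + (2 * t * (a (X n) y - l y) + t\<^sup>2 * a y y)" for n
        using XD[of n] XS[of n] y yD in_D subspace_scale[OF S(1)] unfolding F_def
        by (simp add: a_simps add scale sym[of y "X n"] power2_eq_square algebra_simps)
      finally have "0 \<le> inverse (real (Suc n)) + (2 * t * (a (X n) y - l y) + t\<^sup>2 * a y y)" for n
        using X[of n] by (smt (verit))
      moreover have "(\<lambda>n. inverse (real (Suc n)) + (2 * t * (a (X n) y - l y) + t\<^sup>2 * a y y))
          \<longlonglongrightarrow> 0 + (2 * t * p + t\<^sup>2 * a y y)"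
        unfolding p_def
        by (intro tendsto_intros LIMSEQ_inverse_real_of_nat tendsto_form(1)[OF XD z lim yD])
      ultimately have "0 \<le> 0 + (2 * t * p + t\<^sup>2 * a y y)"
        by (intro LIMSEQ_le_const) auto
      then show ?thesis by simp
    qed
    \<comment> \<open>The quadratic in \<open>t\<close> is tested at \<open>-p\<close> in the
      degenerate case and at its minimiser \<open>-p / a y y\<close> otherwise.\<close>
    have "p = 0"
    proof (cases "a y y = 0")
      case True
      from ineq[of "-p"] True have "p * p \<le> 0" by simp
      then show ?thesis by (metis mult_eq_0_iff order_antisym zero_le_square)
    next
      case False
      then have ay: "a y y > 0" using nonneg[OF yD] by simp
      have "0 \<le> - (p\<^sup>2 / a y y)"
        using ineq[of "- p / a y y"] ay by (simp add: power2_eq_square field_simps)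
      then have "p\<^sup>2 \<le> 0" using ay by (simp add: divide_le_0_iff zero_le_divide_iff)
      then show ?thesis by simp
    qed
    then show ?thesis by (simp add: p_def)
  qed
  then show thesis using that z XS lim by blast
qed

text \<open>
  The representing operator \<open>L\<close> of \<open>c\<close>, given by \<open>a x (L y) = c x y\<close>, is bounded below by coercivity,
  hence has closed range, and the range is dense because a vector \<open>u\<close> orthogonal to it satisfies
  \<open>c u u = a u (L u) = 0\<close>.
\<close>

lemma Lax_Milgram:
  assumes c: "bilinear_on D c"
    and bound: "\<And>x y. \<lbrakk>x \<in> D; y \<in> D\<rbrakk> \<Longrightarrow> \<bar>c x y\<bar> \<le> M * fnorm x * fnorm y"
    and m: "m > 0" and coercive: "\<And>x. x \<in> D \<Longrightarrow> m * a x x \<le> c x x"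
    and add: "\<And>x y. \<lbrakk>x \<in> D; y \<in> D\<rbrakk> \<Longrightarrow> l (x + y) = l x + l y"
    and scale: "\<And>r x. x \<in> D \<Longrightarrow> l (r *\<^sub>R x) = r * l x"
    and l_bound: "\<And>x. x \<in> D \<Longrightarrow> \<bar>l x\<bar> \<le> K * fnorm x"
  obtains y where "y \<in> D" "\<And>x. x \<in> D \<Longrightarrow> c x y = l x"
proof -
  note c_simps = bilinear_on_simps[OF c]
  obtain z where z: "z \<in> D" "\<And>x. x \<in> D \<Longrightarrow> a z x = l x"
    using Riesz_on_subspace[OF sub order_refl add scale l_bound] by metis
  \<comment> \<open>The range of \<open>L\<close>, described without naming
    \<open>L\<close>.\<close>
  define S where "S = {w \<in> D. \<exists>y\<in>D. \<forall>x\<in>D. a x w = c x y}"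
  have SD: "S \<subseteq> D" by (auto simp: S_def)
  have S: "subspace S"
  proof (rule subspaceI)
    have "c x 0 = 0" if "x \<in> D" for x
      using bilinear_on_scale_right[OF c that that, of 0] by simp
    moreover have "a x 0 = 0" if "x \<in> D" for x
      using bilinear_on_scale_right[OF bilin that that, of 0] by simp
    ultimately show "0 \<in> S" unfolding S_def using in_D(4) by auto
  next
    fix w w' assume "w \<in> S" "w' \<in> S"
    then obtain y y' where "w \<in> D" "w' \<in> D" "y \<in> D" "y' \<in> D"
      "\<forall>x\<in>D. a x w = c x y" "\<forall>x\<in>D. a x w' = c x y'" unfolding S_def by blast
    then have "\<forall>x\<in>D. a x (w + w') = c x (y + y')" "w + w' \<in> D" "y + y' \<in> D"
      by (simp_all add: in_D a_simps c_simps)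
    then show "w + w' \<in> S" unfolding S_def by blast
  next
    fix r w assume "w \<in> S"
    then obtain y where "w \<in> D" "y \<in> D" "\<forall>x\<in>D. a x w = c x y" unfolding S_def by blast
    then have "\<forall>x\<in>D. a x (r *\<^sub>R w) = c x (r *\<^sub>R y)" "r *\<^sub>R w \<in> D" "r *\<^sub>R y \<in> D"
      by (simp_all add: in_D a_simps c_simps)
    then show "r *\<^sub>R w \<in> S" unfolding S_def by blast
  qed
  \<comment> \<open>\<open>z'\<close> is the orthogonal projection of \<open>z\<close> onto the
    closure of \<open>S\<close>, approximated by \<open>W\<close> from within
    \<open>S\<close>.\<close>
  obtain z' W where z': "z' \<in> D" "\<And>w. w \<in> S \<Longrightarrow> a z' w = a z w"
    and W: "\<And>n::nat. W n \<in> S" and limW: "(\<lambda>n. a (W n - z') (W n - z')) \<longlonglongrightarrow> 0"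
    by (rule Riesz_on_subspace[OF S SD, of "a z" "fnorm z"])
      (use SD z(1) in_D Cauchy_Schwarz in \<open>auto simp: a_simps subset_iff\<close>)
  have "z - z' = 0"
  proof (rule eq_zero)
    let ?u = "z - z'"
    show u: "?u \<in> D" using z z' in_D by simp
    \<comment> \<open>Here \<open>w = L ?u\<close> lies in \<open>S\<close>, and \<open>?u\<close>
      is orthogonal to \<open>S\<close>; this makes \<open>c ?u ?u\<close> vanish.\<close>
    obtain w where w: "w \<in> D" "\<And>x. x \<in> D \<Longrightarrow> a w x = c x ?u"
      by (rule Riesz_on_subspace[OF sub order_refl, of "\<lambda>x. c x ?u" "M * fnorm ?u"])
        (use u in_D bound in \<open>auto simp: c_simps mult.commute mult.left_commute\<close>)
    then have "w \<in> S" unfolding S_def using u sym by auto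
    then have "a ?u w = 0" using z'(2)[of w] w(1) z(1) z'(1) by (simp add: a_simps)
    then have "c ?u ?u = 0" using w(2)[OF u] sym[OF w(1) u] by simp
    then have "m * a ?u ?u \<le> 0" using coercive[OF u] by simp
    then show "a ?u ?u \<le> 0" using m by (simp add: mult_le_0_iff)
  qed
  then have zz: "z' = z" by simp
  have WD: "W n \<in> D" for n using W SD by blast
  have "\<exists>y\<in>D. \<forall>x\<in>D. a x (W n) = c x y" for n using W[of n] unfolding S_def by blast
  then obtain Y where Y: "\<And>n. Y n \<in> D" "\<And>n x. x \<in> D \<Longrightarrow> a x (W n) = c x (Y n)" by metis
  \<comment> \<open>Coercivity makes the inverse of \<open>L\<close> Lipschitz with constant
    \<open>1 / m\<close>, so the preimages \<open>Y\<close> of the convergent \<open>W\<close> are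
    form-Cauchy.\<close>
  have Y_le: "fnorm (Y i - Y j) \<le> (fnorm (W i - z) + fnorm (W j - z)) / m" for i j
  proof -
    let ?d = "Y i - Y j" and ?e = "W i - W j"
    have d: "?d \<in> D" and e: "?e \<in> D" and zi: "W i - z \<in> D" and zj: "z - W j \<in> D"
      using Y WD z in_D by simp_all
    have "m * (fnorm ?d)\<^sup>2 \<le> c ?d ?d" using coercive[OF d] fnorm_square[OF d] by simp
    also have "\<dots> = a ?d ?e" using Y d WD by (simp add: c_simps a_simps)
    also have "\<dots> \<le> fnorm ?d * fnorm ?e" using Cauchy_Schwarz[OF d e] by simp
    finally have "fnorm ?d * (m * fnorm ?d) \<le> fnorm ?d * fnorm ?e"
      by (simp add: power2_eq_square algebra_simps)
    then have "m * fnorm ?d \<le> fnorm ?e"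
      using fnorm_nonneg[OF d] fnorm_nonneg[OF e] by (cases "fnorm ?d = 0") auto
    also have "fnorm ?e \<le> fnorm (W i - z) + fnorm (z - W j)"
      using fnorm_triangle[OF zi zj] by simp
    also have "fnorm (z - W j) = fnorm (W j - z)"
      using z WD in_D by (simp add: fnorm_def a_simps)
    finally show ?thesis using m by (simp add: field_simps)
  qed
  have limW': "(\<lambda>n. fnorm (W n - z)) \<longlonglongrightarrow> 0"
    using tendsto_real_sqrt[OF limW] by (simp add: fnorm_def zz)
  have "\<exists>N. \<forall>i\<ge>N. \<forall>j\<ge>N. a (Y i - Y j) (Y i - Y j) < e" if "e > 0" for e
  proof -
    have "m * sqrt e / 2 > 0" using m \<open>e > 0\<close> by simp
    from order_tendstoD(2)[OF limW' this] obtain N where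
      N: "\<And>n. n \<ge> N \<Longrightarrow> fnorm (W n - z) < m * sqrt e / 2"
      unfolding eventually_sequentially by blast
    have "a (Y i - Y j) (Y i - Y j) < e" if "i \<ge> N" "j \<ge> N" for i j
    proof -
      have "fnorm (W i - z) + fnorm (W j - z) < m * sqrt e" using N[OF that(1)] N[OF that(2)] by simp
      then have "fnorm (Y i - Y j) < sqrt e"
        using Y_le[of i j] m by (smt (verit, ccfv_SIG) divide_less_eq mult.commute)
      then show ?thesis by (simp add: fnorm_def)
    qed
    then show ?thesis by blast
  qed
  from complete[OF Y(1) this] obtain y where y: "y \<in> D" and
    limY: "(\<lambda>n. a (Y n - y) (Y n - y)) \<longlonglongrightarrow> 0" by blast
  have "c x y = l x" if x: "x \<in> D" for x
  proof -
    \<comment> \<open>Both sides of \<open>c x (Y n) = a x (W n)\<close> converge, the left by the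
      bound on \<open>c\<close>, the right to \<open>l x\<close>.\<close>
    have "(\<lambda>n. c x (Y n)) \<longlonglongrightarrow> c x y"
    proof (rule LIM_zero_cancel, rule Lim_null_comparison)
      show "\<forall>\<^sub>F n in sequentially. norm (c x (Y n) - c x y) \<le> M * fnorm x * fnorm (Y n - y)"
        using bound[OF x, of "Y n - y" for n] Y(1) x y in_D by (auto simp: c_simps)
      show "(\<lambda>n. M * fnorm x * fnorm (Y n - y)) \<longlonglongrightarrow> 0"
        using tendsto_mult_left[OF tendsto_real_sqrt[OF limY], of "M * fnorm x"]
        by (simp add: fnorm_def)
    qed
    moreover have "(\<lambda>n. a (W n) x) \<longlonglongrightarrow> a z x"
      using tendsto_form(1)[OF WD z(1) limW[unfolded zz] x] .
    then have "(\<lambda>n. c x (Y n)) \<longlonglongrightarrow> l x"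
      using z(2)[OF x] Y(2)[OF x] sym[OF x WD] by simp
    ultimately show ?thesis by (rule LIMSEQ_unique)
  qed
  with y that show thesis by blast
qed

end

section \<open>Self-adjoint operators\<close>

lemma cinner_add_left: "cinner (x + y) z = cinner x z + cinner y z"
  for x y z :: "'h::complex_hilbert"
  by (simp add: cinner_commute[of _ z] cinner_add_right)

lemma cinner_scaleC_left: "cinner (c *\<^sub>C x) y = cnj c * cinner x y" for x y :: "'h::complex_hilbert"
  by (simp add: cinner_commute[of _ y] cinner_scaleC_right)

lemma cinner_diff_right: "cinner x (y - z) = cinner x y - cinner x z"
  for x y z :: "'h::complex_hilbert"
  using cinner_add_right[of x "y - z" z] by simp

lemma Im_cinner: "Im (cinner x y) = inner (\<i> *\<^sub>C x) y" for x y :: "'h::complex_hilbert"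
  by (simp add: inner_eq_Re_cinner cinner_scaleC_left)

lemma norm_square_cinner: "Re (cinner x x) = (norm x)\<^sup>2" for x :: "'h::complex_hilbert"
  by (simp add: inner_eq_Re_cinner[symmetric] power2_norm_eq_inner)

lemma csubspace_scaleR: "\<lbrakk>csubspace D; x \<in> D\<rbrakk> \<Longrightarrow> r *\<^sub>R x \<in> D"
  by (simp add: csubspace_def scaleR_scaleC)

lemma csubspace_imp_subspace: "csubspace D \<Longrightarrow> subspace D"
  unfolding subspace_def using csubspace_scaleR by (auto simp: csubspace_def)

lemma orthogonal_to_dense:
  fixes z :: "'a::real_inner"
  assumes "closure D = UNIV" and "\<And>x. x \<in> D \<Longrightarrow> inner x z = 0"
  shows "z = 0"
proof -
  have "closed {x. inner x z = 0}" by (intro closed_Collect_eq continuous_intros)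
  then have "closure D \<subseteq> {x. inner x z = 0}" using assms(2) by (intro closure_minimal) auto
  then have "inner z z = 0" using assms(1) by blast
  then show ?thesis by simp
qed

lemma eq_if_cinner_eq_dense:
  fixes y z :: "'h::complex_hilbert"
  assumes "closure D = UNIV" and "\<And>x. x \<in> D \<Longrightarrow> cinner x y = cinner x z"
  shows "y = z"
proof -
  have "y - z = 0"
    by (rule orthogonal_to_dense[OF assms(1)])
      (simp add: inner_eq_Re_cinner cinner_diff_right assms(2))
  then show ?thesis by simp
qed

lemma app_eq: "T x = Some y \<Longrightarrow> app T x = y"
  by (simp add: app_def)

text \<open>Density makes the candidate vector unique, so the definite description can be
  eliminated.\<close>

lemma adjoint_operator_eq_Some_iff:
  assumes "closure (dom T) = UNIV"
  shows "adjoint_operator T y = Some z \<longleftrightarrow> (\<forall>x\<in>dom T. cinner (app T x) y = cinner x z)"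
proof (cases "\<exists>z. \<forall>x\<in>dom T. cinner (app T x) y = cinner x z")
  case True
  then obtain w where w: "\<forall>x\<in>dom T. cinner (app T x) y = cinner x w" by blast
  then have *: "(\<forall>x\<in>dom T. cinner (app T x) y = cinner x z) \<longleftrightarrow> z = w" for z
    using eq_if_cinner_eq_dense[OF assms, of z w] by auto
  show ?thesis unfolding adjoint_operator_def * by auto
next
  case False
  then show ?thesis unfolding adjoint_operator_def by auto
qed

text \<open>Read from right to left, a relation tested only against \<open>dom T\<close> puts
  \<open>y\<close> into the domain. Weak solutions become elements of the domains of
  \<open>A\<close> and \<open>B\<close> this way.\<close>

lemma self_adjoint_eq_Some_iff:
  assumes "self_adjoint T"
  shows "T y = Some z \<longleftrightarrow> (\<forall>x\<in>dom T. cinner (app T x) y = cinner x z)"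
  using adjoint_operator_eq_Some_iff[of T y z] assms unfolding self_adjoint_def by metis

text \<open>Makes \<open>Riesz_on_subspace\<close> available for the Hilbert space itself, as a
  density criterion.\<close>

interpretation inner_form: complete_real_form UNIV "inner :: 'a::{real_inner,complete_space} \<Rightarrow> _"
proof
  show "bilinear_on UNIV (inner :: 'a \<Rightarrow> 'a \<Rightarrow> real)"
    by (simp add: bilinear_on_def inner_add_left inner_add_right)
next
  fix X :: "nat \<Rightarrow> 'a"
  assume *: "\<And>e. e > 0 \<Longrightarrow> \<exists>N. \<forall>m\<ge>N. \<forall>n\<ge>N. inner (X m - X n) (X m - X n) < e"
  have "Cauchy X"
  proof (rule metric_CauchyI)
    fix e :: real assume e: "e > 0"
    have "dist (X m) (X n) < e" if "inner (X m - X n) (X m - X n) < e\<^sup>2" for m n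
      using that e by (simp add: dist_norm power2_norm_eq_inner[symmetric] power2_less_imp_less)
    moreover obtain N where "\<forall>m\<ge>N. \<forall>n\<ge>N. inner (X m - X n) (X m - X n) < e\<^sup>2"
      using *[of "e\<^sup>2"] e by auto
    ultimately show "\<exists>M. \<forall>m\<ge>M. \<forall>n\<ge>M. dist (X m) (X n) < e" by blast
  qed
  then obtain x where "X \<longlonglongrightarrow> x" using Cauchy_convergent_iff convergent_def by metis
  then have "(\<lambda>n. inner (X n - x) (X n - x)) \<longlonglongrightarrow> inner (x - x) (x - x)"
    by (intro tendsto_intros)
  then show "\<exists>x\<in>UNIV. (\<lambda>n. inner (X n - x) (X n - x)) \<longlonglongrightarrow> 0" by auto
next
  fix x y :: 'a
  show "inner x y = inner y x" by (rule inner_commute)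
  show "0 < inner x x" if "x \<noteq> 0" using that by simp
qed

text \<open>Represent \<open>inner z\<close> on \<open>S\<close>: the representing vector is a limit
  from \<open>S\<close>, and it differs from \<open>z\<close> by a vector orthogonal to
  \<open>S\<close>.\<close>

lemma dense_if_orthogonal_trivial:
  fixes S :: "'a::{real_inner,complete_space} set"
  assumes S: "subspace S" and orth: "\<And>z. (\<And>y. y \<in> S \<Longrightarrow> inner z y = 0) \<Longrightarrow> z = 0"
  shows "closure S = UNIV"
proof (intro set_eqI iffI UNIV_I)
  fix z :: 'a
  obtain z' X where z': "\<And>y. y \<in> S \<Longrightarrow> inner z' y = inner z y" and X: "\<And>n::nat. X n \<in> S"
    and lim: "(\<lambda>n. inner (X n - z') (X n - z')) \<longlonglongrightarrow> 0"
    by (rule inner_form.Riesz_on_subspace[OF S subset_UNIV, of "inner z" "norm z"])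
      (auto simp: inner_add_right inner_form.fnorm_def norm_eq_sqrt_inner[symmetric]
        intro: Cauchy_Schwarz_ineq2)
  have "z' - z = 0" by (rule orth) (simp add: z' inner_diff_left)
  moreover have "(\<lambda>n. norm (X n - z')) \<longlonglongrightarrow> 0"
    using tendsto_real_sqrt[OF lim] by (simp add: norm_eq_sqrt_inner)
  then have "X \<longlonglongrightarrow> z'" by (rule LIM_zero_cancel[OF tendsto_norm_zero_cancel])
  ultimately have "X \<longlonglongrightarrow> z" by simp
  then show "z \<in> closure S" unfolding closure_sequential using X by (intro exI[of _ X]) simp
qed

section \<open>Inverses of injective symmetric operators\<close>

definition inverse_operator :: "('h \<Rightarrow> 'h) \<Rightarrow> 'h oper" where
  "inverse_operator S = (\<lambda>x. if x \<in> range S then Some (inv S x) else None)"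

lemma inverse_operator_eq_Some_iff:
  assumes "inj S"
  shows "inverse_operator S x = Some f \<longleftrightarrow> S f = x"
proof (cases "x \<in> range S")
  case True
  then obtain g where "x = S g" by blast
  then show ?thesis using assms by (auto simp: inverse_operator_def inj_eq)
next
  case False
  then show ?thesis by (auto simp: inverse_operator_def)
qed

text \<open>By symmetry the complement of the range of \<open>S\<close> lies in its kernel, so
  injectivity gives a dense domain. The adjoint relation, tested on all \<open>S f\<close>, reads
  \<open>S z = y\<close>, which is the graph of the inverse.\<close>

lemma self_adjoint_inverse_operator:
  fixes S :: "'h::complex_hilbert \<Rightarrow> 'h"
  assumes add: "\<And>f g. S (f + g) = S f + S g" and scale: "\<And>c f. S (c *\<^sub>C f) = c *\<^sub>C S f"
    and sym: "\<And>f g. cinner (S f) g = cinner f (S g)" and inj: "inj S"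
  shows "self_adjoint (inverse_operator S)"
proof -
  let ?T = "inverse_operator S"
  have dom: "dom ?T = range S" by (auto simp: inverse_operator_def dom_def)
  have app: "app ?T (S f) = f" for f
    by (simp add: app_eq inverse_operator_eq_Some_iff[OF inj])
  have S0: "S 0 = 0" using add[of 0 0] by simp
  have csub: "csubspace (range S)"
    unfolding csubspace_def
    using S0 add scale by (auto simp: image_iff) metis+
  have dense: "closure (dom ?T) = UNIV"
    unfolding dom
  proof (rule dense_if_orthogonal_trivial[OF csubspace_imp_subspace[OF csub]])
    fix z assume "\<And>y. y \<in> range S \<Longrightarrow> inner z y = 0"
    then have "inner (S z) f = 0" for f by (simp add: inner_eq_Re_cinner sym)
    then have "S z = S 0" using S0 by (metis inner_eq_zero_iff)
    then show "z = 0" using inj by (simp add: inj_eq)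
  qed
  have "linear_operator ?T"
    unfolding linear_operator_def dom
  proof (intro conjI ballI allI)
    fix x y assume "x \<in> range S" "y \<in> range S"
    then obtain f g where "x = S f" "y = S g" by blast
    then show "app ?T (x + y) = app ?T x + app ?T y" using app add by metis
  next
    fix c x assume "x \<in> range S"
    then obtain f where "x = S f" by blast
    then show "app ?T (c *\<^sub>C x) = c *\<^sub>C app ?T x" using app scale by metis
  qed (rule csub)
  moreover have "adjoint_operator ?T y = Some z \<longleftrightarrow> ?T y = Some z" for y z
  proof -
    have "adjoint_operator ?T y = Some z \<longleftrightarrow> (\<forall>f. cinner f y = cinner f (S z))"
      unfolding adjoint_operator_eq_Some_iff[OF dense] dom by (simp add: app sym)
    also have "\<dots> \<longleftrightarrow> S z = y" using eq_if_cinner_eq_dense[of UNIV y "S z"] by auto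
    finally show ?thesis by (simp add: inverse_operator_eq_Some_iff[OF inj])
  qed
  then have "adjoint_operator ?T = ?T" by (metis ext option.exhaust)
  ultimately show ?thesis unfolding self_adjoint_def using dense by blast
qed

lemma commutes_with_operator_quadratic_form:
  assumes J: "self_adjoint_involution J" and "commutes_with_operator J A" and x: "x \<in> dom A"
  shows "J x \<in> dom A" and "cinner (J x) (app A (J x)) = cinner x (app A x)"
proof -
  obtain E where E: "spectral_measure_of A E" and
    com: "\<And>S x. S \<in> sets borel \<Longrightarrow> J (E S x) = E S (J x)"
    using assms(2) unfolding commutes_with_operator_def by (elim exE conjE) simp
  \<comment> \<open>Move \<open>J\<close> through \<open>E S\<close> and across the inner product,
    then use \<open>J (J x) = x\<close>.\<close>
  have "cinner (J x) (E S (J x)) = cinner x (E S x)" if "S \<in> sets borel" for S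
    using J com[OF that] unfolding self_adjoint_involution_def bounded_self_adjoint_def by metis
  then have eq: "scalar_spectral_measure E (J x) = scalar_spectral_measure E x"
    unfolding scalar_spectral_measure_def
    by (intro measure_of_eq) (auto simp: sets.sigma_sets_eq[of borel, simplified])
  show Jx: "J x \<in> dom A" using E x eq unfolding spectral_measure_of_def by auto
  show "cinner (J x) (app A (J x)) = cinner x (app A x)"
    using E x Jx eq unfolding spectral_measure_of_def by auto
qed

section \<open>Closed forms on Hilbert spaces\<close>

lemma sesquilinear_form_imp_bilinear_on:
  "sesquilinear_form D c \<Longrightarrow> bilinear_on D (\<lambda>x y. Re (c x y))"
  unfolding sesquilinear_form_def bilinear_on_def
  by (auto simp: scaleR_scaleC csubspace_imp_subspace)

text \<open>By conjugate-linearity in the first argument. Identities of forms need checking on real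
  parts only.\<close>

lemma sesquilinear_form_Im:
  assumes "sesquilinear_form D c" "x \<in> D" "y \<in> D"
  shows "Im (c x y) = Re (c (\<i> *\<^sub>C x) y)"
proof -
  have "c (\<i> *\<^sub>C x) y = cnj \<i> * c x y"
    using assms unfolding sesquilinear_form_def by blast
  then show ?thesis by simp
qed

lemma sesquilinear_form_eqI:
  assumes c: "sesquilinear_form D c" and d: "sesquilinear_form D d"
    and Re: "\<And>x. x \<in> D \<Longrightarrow> Re (c x y) = Re (d x y)" and x: "x \<in> D" and y: "y \<in> D"
  shows "c x y = d x y"
proof (rule complex_eqI)
  have "\<i> *\<^sub>C x \<in> D" using c x unfolding sesquilinear_form_def csubspace_def by blast
  then show "Im (c x y) = Im (d x y)"
    using Re by (simp add: sesquilinear_form_Im[OF c x y] sesquilinear_form_Im[OF d x y])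
qed (rule Re[OF x])

locale closed_positive_form =
  fixes Da :: "'h::complex_hilbert set" and a :: "'h form" and \<alpha> :: real
  assumes form: "symmetric_form Da a" and dense: "closure Da = UNIV"
    and closed: "closed_form Da a" and lower: "form_lower_bound Da a \<alpha>" and \<alpha>: "\<alpha> > 0"
begin

lemma csub: "csubspace Da" and sesq: "sesquilinear_form Da a"
  using form unfolding symmetric_form_def sesquilinear_form_def by blast+

lemma form_commute: "\<lbrakk>x \<in> Da; y \<in> Da\<rbrakk> \<Longrightarrow> a x y = cnj (a y x)"
  using form unfolding symmetric_form_def by blast

lemma form_square: "x \<in> Da \<Longrightarrow> a x x = complex_of_real (Re (a x x))"
  using form_commute[of x x] by (simp add: complex_eq_iff)

lemma lower_bound: "x \<in> Da \<Longrightarrow> \<alpha> * (norm x)\<^sup>2 \<le> Re (a x x)"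
  using lower unfolding form_lower_bound_def by blast

lemma scaleC_in: "x \<in> Da \<Longrightarrow> c *\<^sub>C x \<in> Da"
  using csub unfolding csubspace_def by blast

text \<open>The lower bound makes form-Cauchy sequences norm-Cauchy; the norm limit exists in the
  Hilbert space, and closedness turns it into a form limit.\<close>

sublocale complete_real_form Da "\<lambda>x y. Re (a x y)"
proof
  show "bilinear_on Da (\<lambda>x y. Re (a x y))" by (rule sesquilinear_form_imp_bilinear_on[OF sesq])
  show "Re (a x y) = Re (a y x)" if "x \<in> Da" "y \<in> Da" for x y
    using form_commute[OF that] by simp
  show "0 < Re (a x x)" if "x \<in> Da" "x \<noteq> 0" for x
  proof -
    have "0 < \<alpha> * (norm x)\<^sup>2" using \<alpha> that by simp
    then show ?thesis using lower_bound[OF that(1)] by linarith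
  qed
  fix X assume X: "\<And>n. X n \<in> Da"
    and C: "\<And>e. e > 0 \<Longrightarrow> \<exists>N::nat. \<forall>m\<ge>N. \<forall>n\<ge>N. Re (a (X m - X n) (X m - X n)) < e"
  have D: "X m - X n \<in> Da" for m n
    using subspace_diff[OF csubspace_imp_subspace[OF csub]] X by blast
  have nonneg: "0 \<le> Re (a x x)" if "x \<in> Da" for x
  proof -
    have "0 \<le> \<alpha> * (norm x)\<^sup>2" using \<alpha> by simp
    then show ?thesis using lower_bound[OF that] by linarith
  qed
  have cmod: "cmod (a x x) = Re (a x x)" if "x \<in> Da" for x
    using form_square[OF that] nonneg[OF that] by (metis abs_of_nonneg norm_of_real)
  have "Cauchy X"
  proof (rule metric_CauchyI)
    fix e :: real assume e: "e > 0"
    then have "\<alpha> * e\<^sup>2 > 0" using \<alpha> by simp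
    from C[OF this] obtain N
      where N: "\<And>m n. \<lbrakk>m \<ge> N; n \<ge> N\<rbrakk> \<Longrightarrow> Re (a (X m - X n) (X m - X n)) < \<alpha> * e\<^sup>2" by blast
    have "dist (X m) (X n) < e" if "m \<ge> N" "n \<ge> N" for m n
    proof -
      have "\<alpha> * (norm (X m - X n))\<^sup>2 < \<alpha> * e\<^sup>2"
        using lower_bound[OF D] N[OF that] by (rule order.strict_trans1)
      then have "(norm (X m - X n))\<^sup>2 < e\<^sup>2" using \<alpha> by simp
      then show ?thesis using e by (simp add: dist_norm power2_less_imp_less)
    qed
    then show "\<exists>M. \<forall>m\<ge>M. \<forall>n\<ge>M. dist (X m) (X n) < e" by blast
  qed
  then obtain x where "X \<longlonglongrightarrow> x" using Cauchy_convergent_iff convergent_def by metis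
  moreover have "\<forall>e>0. \<exists>N. \<forall>m\<ge>N. \<forall>n\<ge>N. cmod (a (X m - X n) (X m - X n)) < e"
    using C by (simp add: cmod[OF D])
  ultimately have "x \<in> Da" and "(\<lambda>n. a (X n - x) (X n - x)) \<longlonglongrightarrow> 0"
    using closed X unfolding closed_form_def by blast+
  then show "\<exists>x\<in>Da. (\<lambda>n. Re (a (X n - x) (X n - x))) \<longlonglongrightarrow> 0"
    using tendsto_Re by fastforce
qed

section \<open>Solvability of form equations and the form core \<open>dom A\<close>\<close>

lemma norm_le_fnorm: "x \<in> Da \<Longrightarrow> sqrt \<alpha> * norm x \<le> fnorm x"
  using real_sqrt_le_mono[OF lower_bound] by (simp add: fnorm_def real_sqrt_mult)

text \<open>Each factor contributes \<open>sqrt \<alpha>\<close>. The resulting constant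
  \<open>\<alpha>\<close> makes \<open>\<bar>l\<bar> < \<alpha>\<close> the coercivity condition for
  a shift by \<open>l\<close>.\<close>

lemma inner_le_fnorm:
  assumes "x \<in> Da" "y \<in> Da"
  shows "\<alpha> * (norm x * norm y) \<le> fnorm x * fnorm y"
proof -
  have "(sqrt \<alpha> * norm x) * (sqrt \<alpha> * norm y) \<le> fnorm x * fnorm y"
    using \<alpha> norm_le_fnorm assms fnorm_nonneg by (intro mult_mono) auto
  moreover have "(sqrt \<alpha> * norm x) * (sqrt \<alpha> * norm y) = (sqrt \<alpha> * sqrt \<alpha>) * (norm x * norm y)"
    by (simp only: mult_ac)
  ultimately show ?thesis using \<alpha> by simp
qed

text \<open>The real Lax-Milgram theorem matches real parts; testing at
  \<open>\<i> *\<^sub>C x\<close> then matches imaginary parts.\<close>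

lemma Lax_Milgram_complex:
  assumes c: "sesquilinear_form Da c"
    and bound: "\<And>x y. \<lbrakk>x \<in> Da; y \<in> Da\<rbrakk> \<Longrightarrow> \<bar>Re (c x y)\<bar> \<le> M * fnorm x * fnorm y"
    and m: "m > 0" and coercive: "\<And>x. x \<in> Da \<Longrightarrow> m * Re (a x x) \<le> Re (c x x)"
  obtains y where "y \<in> Da" "\<And>x. x \<in> Da \<Longrightarrow> c x y = cinner x f"
proof -
  have "\<bar>inner x f\<bar> \<le> norm f / sqrt \<alpha> * fnorm x" if "x \<in> Da" for x
  proof -
    have "\<bar>inner x f\<bar> \<le> norm x * norm f" by (rule Cauchy_Schwarz_ineq2)
    also have "norm x \<le> fnorm x / sqrt \<alpha>"
      using norm_le_fnorm[OF that] \<alpha> by (simp add: field_simps)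
    finally show ?thesis by (simp add: mult_right_mono mult.commute)
  qed
  from Lax_Milgram[OF sesquilinear_form_imp_bilinear_on[OF c] bound m coercive _ _ this]
  obtain y where y: "y \<in> Da" and eq: "\<And>x. x \<in> Da \<Longrightarrow> Re (c x y) = inner x f"
    by (auto simp: inner_add_left)
  have "c x y = cinner x f" if x: "x \<in> Da" for x
  proof (rule complex_eqI)
    show "Im (c x y) = Im (cinner x f)"
      unfolding sesquilinear_form_Im[OF c x y] Im_cinner using eq[OF scaleC_in[OF x]] .
  qed (use eq[OF x] in \<open>simp add: inner_eq_Re_cinner\<close>)
  with y that show thesis by blast
qed

text \<open>A weak solution exists in the form domain, and self-adjointness puts it into
  \<open>dom A\<close>.\<close>

lemma associated_operator_surj:
  assumes A: "associated_operator Da a A"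
  obtains y where "A y = Some f"
proof -
  have sa: "self_adjoint A" and sub: "dom A \<subseteq> Da"
    and eq: "\<And>x y. \<lbrakk>x \<in> Da; y \<in> dom A\<rbrakk> \<Longrightarrow> a x y = cinner x (app A y)"
    using A unfolding associated_operator_def by blast+
  \<comment> \<open>Relative to its own norm the form has bound 1 and coercivity constant 1.\<close>
  obtain y where y: "y \<in> Da" "\<And>x. x \<in> Da \<Longrightarrow> a x y = cinner x f"
    by (rule Lax_Milgram_complex[OF sesq, of 1 1 f]) (use Cauchy_Schwarz in auto)
  have "cinner (app A x) y = cinner x f" if "x \<in> dom A" for x
    using eq[OF y(1) that] y form_commute[of x y] sub that cinner_commute[of "app A x" y] by auto
  then have "A y = Some f" using self_adjoint_eq_Some_iff[OF sa] by blast
  then show thesis by (rule that)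
qed

text \<open>If \<open>u\<close> is form-orthogonal to \<open>dom A\<close>, solve
  \<open>A y = u\<close>; then \<open>\<langle>u, u\<rangle> = a u y\<close> has real part zero, so
  \<open>u = 0\<close>.\<close>

lemma associated_operator_core:
  assumes A: "associated_operator Da a A" and z: "z \<in> Da"
  obtains X where "\<And>n::nat. X n \<in> dom A" "(\<lambda>n. Re (a (X n - z) (X n - z))) \<longlonglongrightarrow> 0"
proof -
  have lin: "linear_operator A" and sub: "dom A \<subseteq> Da"
    and eq: "\<And>x y. \<lbrakk>x \<in> Da; y \<in> dom A\<rbrakk> \<Longrightarrow> a x y = cinner x (app A y)"
    using A unfolding associated_operator_def self_adjoint_def by blast+
  have S: "subspace (dom A)"
    using lin unfolding linear_operator_def by (intro csubspace_imp_subspace) blast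
  obtain z' X where z': "z' \<in> Da" "\<And>y. y \<in> dom A \<Longrightarrow> Re (a z' y) = Re (a z y)"
    and X: "\<And>n::nat. X n \<in> dom A" and lim: "(\<lambda>n. Re (a (X n - z') (X n - z'))) \<longlonglongrightarrow> 0"
    by (rule Riesz_on_subspace[OF S sub, of "\<lambda>y. Re (a z y)" "fnorm z"])
      (use z sub Cauchy_Schwarz[OF z] a_simps(2,4)[OF z] in \<open>auto simp: subset_iff\<close>)
  let ?u = "z' - z"
  have u: "?u \<in> Da" using z z' in_D by blast
  obtain y where y: "A y = Some ?u" by (rule associated_operator_surj[OF A])
  then have yA: "y \<in> dom A" "y \<in> Da" using sub by auto
  have "inner ?u ?u = Re (a ?u y)"
    using eq[OF u yA(1)] app_eq[of A y, OF y] by (simp add: inner_eq_Re_cinner)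
  also have "\<dots> = 0" using z'(2)[OF yA(1)] a_simps(5)[OF z'(1) z yA(2)] by simp
  finally have "z' = z" by simp
  with X lim that show thesis by blast
qed

text \<open>On the core \<open>dom A\<close> this is the invariance of the spectral measure; the
  rest follows by approximation in the form norm.\<close>

lemma commuting_involution_isometric:
  assumes A: "associated_operator Da a A" and J: "self_adjoint_involution J"
    and com: "commutes_with_operator J A" and z: "z \<in> Da"
  shows "J z \<in> Da" and "Re (a (J z) (J z)) = Re (a z z)"
proof -
  have lin: "linear_operator A" and sub: "dom A \<subseteq> Da"
    and eq: "\<And>x y. \<lbrakk>x \<in> Da; y \<in> dom A\<rbrakk> \<Longrightarrow> a x y = cinner x (app A y)"
    using A unfolding associated_operator_def self_adjoint_def by blast+
  have S: "subspace (dom A)"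
    using lin unfolding linear_operator_def by (intro csubspace_imp_subspace) blast
  have bl: "bounded_linear J"
    using J unfolding self_adjoint_involution_def bounded_self_adjoint_def bounded_clinear_def
    by blast
  note J_dom = commutes_with_operator_quadratic_form(1)[OF J com]
  have iso: "a (J x) (J x) = a x x" if "x \<in> dom A" for x
    using commutes_with_operator_quadratic_form[OF J com that] eq that sub by (auto simp: subset_iff)
  obtain X where X: "\<And>n. X n \<in> dom A" and lim: "(\<lambda>n. Re (a (X n - z) (X n - z))) \<longlonglongrightarrow> 0"
    using associated_operator_core[OF A z] by metis
  have XD: "X n \<in> Da" and JXD: "J (X n) \<in> Da" for n using X J_dom sub by blast+
  have iso_diff: "a (J (X m) - J (X n)) (J (X m) - J (X n)) = a (X m - X n) (X m - X n)" for m n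
    using iso[OF subspace_diff[OF S X X], of m n] by (simp add: linear_diff[OF bounded_linear.linear[OF bl]])
  have lim': "(\<lambda>n. fnorm (X n - z)) \<longlonglongrightarrow> 0"
    using tendsto_real_sqrt[OF lim] by (simp add: fnorm_def)
  have "\<exists>N. \<forall>m\<ge>N. \<forall>n\<ge>N. Re (a (J (X m) - J (X n)) (J (X m) - J (X n))) < e" if "e > 0" for e
  proof -
    have "sqrt e / 2 > 0" using that by simp
    from order_tendstoD(2)[OF lim' this] obtain N where
      N: "\<And>n. n \<ge> N \<Longrightarrow> fnorm (X n - z) < sqrt e / 2"
      unfolding eventually_sequentially by blast
    have "Re (a (J (X m) - J (X n)) (J (X m) - J (X n))) < e" if "m \<ge> N" "n \<ge> N" for m n
    proof -
      have "fnorm (X m - X n) \<le> fnorm (X m - z) + fnorm (z - X n)"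
        using fnorm_triangle[of "X m - z" "z - X n"] XD z in_D by simp
      also have "fnorm (z - X n) = fnorm (X n - z)"
        using z XD in_D by (simp add: fnorm_def a_simps)
      also have "fnorm (X m - z) + fnorm (X n - z) < sqrt e"
        using N[OF that(1)] N[OF that(2)] by simp
      finally show ?thesis by (simp add: fnorm_def iso_diff)
    qed
    then show ?thesis by blast
  qed
  from complete[OF JXD this] obtain w where w: "w \<in> Da"
    and limJ: "(\<lambda>n. Re (a (J (X n) - w) (J (X n) - w))) \<longlonglongrightarrow> 0" by blast
  \<comment> \<open>Form convergence implies norm convergence, and \<open>J\<close> is
    norm-continuous, so the form limit \<open>w\<close> of \<open>J (X n)\<close> must be
    \<open>J z\<close>.\<close>
  have norm_lim: "Y \<longlonglongrightarrow> y"
    if Y: "\<And>n. Y n \<in> Da" and y: "y \<in> Da" and lim: "(\<lambda>n. Re (a (Y n - y) (Y n - y))) \<longlonglongrightarrow> 0" for Y y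
  proof (rule LIM_zero_cancel, rule Lim_null_comparison)
    have "norm (Y n - y) \<le> fnorm (Y n - y) / sqrt \<alpha>" for n
      using norm_le_fnorm[of "Y n - y"] Y y in_D \<alpha> by (simp add: field_simps)
    then show "\<forall>\<^sub>F n in sequentially. norm (Y n - y) \<le> fnorm (Y n - y) / sqrt \<alpha>" by simp
    show "(\<lambda>n. fnorm (Y n - y) / sqrt \<alpha>) \<longlonglongrightarrow> 0"
      using tendsto_divide[OF tendsto_real_sqrt[OF lim] tendsto_const[of "sqrt \<alpha>"]] \<alpha>
      by (simp add: fnorm_def)
  qed
  have "(\<lambda>n. J (X n)) \<longlonglongrightarrow> J z"
    using bounded_linear.tendsto[OF bl norm_lim[OF XD z lim]] .
  then have Jz: "J z = w" using norm_lim[OF JXD w limJ] by (rule LIMSEQ_unique)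
  then show "J z \<in> Da" using w by simp
  have "(\<lambda>n. Re (a (J (X n)) (J (X n)))) \<longlonglongrightarrow> Re (a w w)"
    by (rule tendsto_form(2)[OF JXD w limJ])
  moreover have "(\<lambda>n. Re (a (X n) (X n))) \<longlonglongrightarrow> Re (a z z)"
    by (rule tendsto_form(2)[OF XD z lim])
  ultimately show "Re (a (J z) (J z)) = Re (a z z)"
    unfolding Jz iso[OF X] by (rule LIMSEQ_unique)
qed

end

section \<open>Off-diagonal perturbations\<close>

text \<open>Commutation of \<open>J\<close> with \<open>A\<close> is represented here by its
  consequences \<open>J_in\<close> and \<open>J_isometric\<close>.\<close>

locale off_diagonal_perturbation = closed_positive_form Da a \<alpha>
  for Da :: "'h::complex_hilbert set" and a :: "'h form" and \<alpha> :: real +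
  fixes v b :: "'h form" and J :: "'h \<Rightarrow> 'h" and K :: real
  assumes v: "sesquilinear_form Da v"
    and v_commute: "\<lbrakk>x \<in> Da; y \<in> Da\<rbrakk> \<Longrightarrow> v x y = cnj (v y x)"
    and v_bound: "x \<in> Da \<Longrightarrow> cmod (v x x) \<le> K * Re (a x x)"
    and J: "self_adjoint_involution J"
    and J_in: "x \<in> Da \<Longrightarrow> J x \<in> Da"
    and J_isometric: "x \<in> Da \<Longrightarrow> Re (a (J x) (J x)) = Re (a x x)"
    and off_diagonal: "\<lbrakk>x \<in> Da; y \<in> Da\<rbrakk> \<Longrightarrow> v (J x) y = - v x (J y)"
    and b: "\<lbrakk>x \<in> Da; y \<in> Da\<rbrakk> \<Longrightarrow> b x y = a x (J y) + v x y"
begin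

section \<open>The involution, symmetry of \<open>b\<close> and bounds on \<open>v\<close>\<close>

lemma J_J [simp]: "J (J x) = x"
  using J unfolding self_adjoint_involution_def by blast

lemma J_scaleC: "J (c *\<^sub>C x) = c *\<^sub>C J x"
  and J_add: "J (x + y) = J x + J y"
  and cinner_J: "cinner (J x) y = cinner x (J y)"
  using J unfolding self_adjoint_involution_def bounded_self_adjoint_def bounded_clinear_def
  by (blast intro: linear_simps(1))+

lemma sesquilinear_J: "sesquilinear_form Da c \<Longrightarrow> sesquilinear_form Da (\<lambda>x y. c (J x) y)"
  "sesquilinear_form Da c \<Longrightarrow> sesquilinear_form Da (\<lambda>x y. c x (J y))"
  unfolding sesquilinear_form_def by (simp_all add: J_in J_add J_scaleC)

text \<open>Polarisation of \<open>J_isometric\<close> in the real part; sesquilinearity supplies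
  the imaginary part.\<close>

lemma a_J_J:
  assumes x: "x \<in> Da" and y: "y \<in> Da"
  shows "a (J x) (J y) = a x y"
proof (rule sesquilinear_form_eqI[OF _ sesq _ x y])
  show "sesquilinear_form Da (\<lambda>x y. a (J x) (J y))"
    by (rule sesquilinear_J(1)[OF sesquilinear_J(2)[OF sesq]])
  show "Re (a (J x) (J y)) = Re (a x y)" if x: "x \<in> Da" for x
  proof -
    have "Re (a (J x + J y) (J x + J y)) = Re (a (x + y) (x + y))"
      using J_isometric[of "x + y"] x y in_D by (simp add: J_add)
    then have "2 * Re (a (J x) (J y)) = 2 * Re (a x y)"
      using x y in_D J_in J_isometric[OF x] J_isometric[OF y] sym[of "J y" "J x"] sym[of y x]
      by (simp add: a_simps del: plus_complex.sel)
    then show ?thesis by simp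
  qed
qed

text \<open>\<open>J\<close> is symmetric for the form \<open>a\<close>, being an isometric
  involution.\<close>

lemma b_commute:
  assumes "x \<in> Da" "y \<in> Da"
  shows "b x y = cnj (b y x)"
proof -
  have "cnj (a y (J x)) = a (J x) y"
    by (rule form_commute[OF J_in[OF assms(1)] assms(2), symmetric])
  also have "\<dots> = a x (J y)" using a_J_J[of x "J y"] assms J_in by simp
  finally show ?thesis using assms v_commute[OF assms] by (simp add: b)
qed

text \<open>\<open>v (J x) x\<close> equals \<open>- v x (J x)\<close>, which is minus its own
  conjugate.\<close>

lemma Re_v_J: "x \<in> Da \<Longrightarrow> Re (v (J x) x) = 0"
  using off_diagonal[of x x] v_commute[of x "J x"] J_in by (simp add: complex_eq_iff)

text \<open>Polarisation expresses \<open>4 * Re (v x y)\<close> through diagonal values of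
  \<open>v\<close>, and the parallelogram law adds up the matching values of \<open>a\<close>. The
  sum bound becomes a product bound with the same \<open>K\<close>.\<close>

lemma v_le:
  assumes "x \<in> Da" "y \<in> Da"
  shows "\<bar>Re (v x y)\<bar> \<le> K * fnorm x * fnorm y"
proof (rule bounded_bilinear_on[OF sesquilinear_form_imp_bilinear_on[OF v] _ assms])
  fix x y assume x: "x \<in> Da" and y: "y \<in> Da"
  note v_simps = bilinear_on_simps[OF sesquilinear_form_imp_bilinear_on[OF v]]
  have *: "\<bar>Re (v z z)\<bar> \<le> K * Re (a z z)" if "z \<in> Da" for z
    using v_bound[OF that] abs_Re_le_cmod order_trans by blast
  have "Re (v y x) = Re (v x y)" using v_commute[OF y x] by simp
  then have "4 * Re (v x y) = Re (v (x + y) (x + y)) - Re (v (x - y) (x - y))"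
    using x y in_D by (simp add: v_simps)
  also have "\<dots> \<le> K * Re (a (x + y) (x + y)) + K * Re (a (x - y) (x - y))"
    using *[of "x + y"] *[of "x - y"] x y in_D by force
  also have "\<dots> = K * (Re (a (x + y) (x + y)) + Re (a (x - y) (x - y)))"
    by (simp add: distrib_left)
  also have "Re (a (x + y) (x + y)) + Re (a (x - y) (x - y)) = 2 * (Re (a x x) + Re (a y y))"
    using x y in_D by (simp add: a_simps)
  finally show "2 * Re (v x y) \<le> K * (Re (a x x) + Re (a y y))" by (simp add: algebra_simps)
qed

text \<open>
  Replacing \<open>x\<close> by \<open>J x\<close> turns the indefinite form \<open>b - \<lambda>\<close> into a coercive one, since the off-diagonal
  part contributes only an imaginary term to the diagonal.
\<close>

definition shifted :: "real \<Rightarrow> 'h form" where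
  "shifted l x y = a x y + v (J x) y - complex_of_real l * cinner (J x) y"

section \<open>Boundedness and coercivity of the shifted form\<close>

lemma shifted_eq:
  assumes "x \<in> Da" "y \<in> Da"
  shows "shifted l x y = b (J x) y - complex_of_real l * cinner (J x) y"
  using assms J_in a_J_J[of x y] by (simp add: shifted_def b)

lemma sesquilinear_shifted: "sesquilinear_form Da (shifted l)"
  using sesq sesquilinear_J(1)[OF v] unfolding shifted_def sesquilinear_form_def
  by (simp add: J_in J_add J_scaleC cinner_add_left cinner_add_right cinner_scaleC_left
      cinner_scaleC_right algebra_simps)

lemma fnorm_J: "x \<in> Da \<Longrightarrow> fnorm (J x) = fnorm x"
  by (simp add: fnorm_def J_isometric)

lemma inner_J_le:
  assumes "x \<in> Da" "y \<in> Da"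
  shows "\<bar>l * inner (J x) y\<bar> \<le> \<bar>l\<bar> / \<alpha> * (fnorm x * fnorm y)"
proof -
  have "\<bar>inner (J x) y\<bar> \<le> norm (J x) * norm y" by (rule Cauchy_Schwarz_ineq2)
  also have "\<dots> \<le> fnorm x * fnorm y / \<alpha>"
    using inner_le_fnorm[of "J x" y] assms J_in \<alpha> by (simp add: field_simps fnorm_J)
  finally have "\<bar>l\<bar> * \<bar>inner (J x) y\<bar> \<le> \<bar>l\<bar> * (fnorm x * fnorm y / \<alpha>)"
    by (rule mult_left_mono) simp
  then show ?thesis by (simp add: abs_mult)
qed

lemma Re_shifted: "Re (shifted l x y) = Re (a x y) + Re (v (J x) y) - l * inner (J x) y"
  by (simp add: shifted_def inner_eq_Re_cinner)

lemma shifted_le: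
  assumes x: "x \<in> Da" and y: "y \<in> Da"
  shows "\<bar>Re (shifted l x y)\<bar> \<le> (1 + K + \<bar>l\<bar> / \<alpha>) * fnorm x * fnorm y"
proof -
  have "\<bar>Re (a x y)\<bar> \<le> fnorm x * fnorm y" by (rule Cauchy_Schwarz[OF x y])
  moreover have "\<bar>Re (v (J x) y)\<bar> \<le> K * fnorm x * fnorm y"
    using v_le[OF J_in[OF x] y] fnorm_J[OF x] by simp
  moreover note inner_J_le[OF x y, of l]
  moreover have "(1 + K + \<bar>l\<bar> / \<alpha>) * fnorm x * fnorm y
      = fnorm x * fnorm y + K * fnorm x * fnorm y + \<bar>l\<bar> / \<alpha> * (fnorm x * fnorm y)"
    by (simp add: algebra_simps)
  ultimately show ?thesis unfolding Re_shifted by linarith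
qed

text \<open>The perturbation drops out of the diagonal, so only the shift costs, and at most the
  fraction \<open>\<bar>l\<bar> / \<alpha>\<close>.\<close>

lemma shifted_coercive:
  assumes x: "x \<in> Da"
  shows "(1 - \<bar>l\<bar> / \<alpha>) * Re (a x x) \<le> Re (shifted l x x)"
proof -
  have "fnorm x * fnorm x = Re (a x x)"
    using fnorm_square[OF x] by (simp add: power2_eq_square)
  then show ?thesis
    using inner_J_le[OF x x, of l] unfolding Re_shifted Re_v_J[OF x] by (simp add: algebra_simps abs_le_iff)
qed

text \<open>The resolvent of \<open>B\<close> at \<open>l\<close> in weak form, available before
  \<open>B\<close> is constructed. For \<open>\<bar>l\<bar> < \<alpha>\<close> the chosen solution
  exists by \<open>Res_exists\<close> and is unique by \<open>Res_eqI\<close>.\<close>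

definition Res :: "real \<Rightarrow> 'h \<Rightarrow> 'h" where
  "Res l f = (SOME y. y \<in> Da \<and> (\<forall>x\<in>Da. b x y - complex_of_real l * cinner x y = cinner x f))"

section \<open>Weak resolvents at real points below \<open>\<alpha>\<close> in modulus\<close>

context
  fixes l :: real
  assumes l: "\<bar>l\<bar> < \<alpha>"
begin

lemma coercivity_pos: "1 - \<bar>l\<bar> / \<alpha> > 0"
  using l \<alpha> by simp

lemma Res_exists:
  "\<exists>y. y \<in> Da \<and> (\<forall>x\<in>Da. b x y - complex_of_real l * cinner x y = cinner x f)"
proof -
  \<comment> \<open>The right-hand side is \<open>J f\<close> because the equation is then tested at
    \<open>J x\<close>, and \<open>J\<close> cancels in
    \<open>\<langle>J x, J f\<rangle>\<close>.\<close>
  obtain y where y: "y \<in> Da" "\<And>x. x \<in> Da \<Longrightarrow> shifted l x y = cinner x (J f)"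
    using Lax_Milgram_complex[OF sesquilinear_shifted shifted_le coercivity_pos shifted_coercive]
    by metis
  have "b x y - complex_of_real l * cinner x y = cinner x f" if "x \<in> Da" for x
    using y(2)[OF J_in[OF that]] y(1) shifted_eq[OF J_in[OF that] y(1), of l] by (simp add: cinner_J)
  with y(1) show ?thesis by blast
qed

lemma Res_in: "Res l f \<in> Da"
  and Res_eq: "x \<in> Da \<Longrightarrow> b x (Res l f) = cinner x (f + complex_of_real l *\<^sub>C Res l f)"
proof -
  have *: "Res l f \<in> Da \<and>
      (\<forall>x\<in>Da. b x (Res l f) - complex_of_real l * cinner x (Res l f) = cinner x f)"
    unfolding Res_def by (rule someI_ex[OF Res_exists])
  show "Res l f \<in> Da" using * by blast
  show "b x (Res l f) = cinner x (f + complex_of_real l *\<^sub>C Res l f)" if "x \<in> Da"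
    unfolding cinner_add_right cinner_scaleC_right using * that diff_eq_eq by blast
qed

lemma shifted_Res: "x \<in> Da \<Longrightarrow> shifted l x (Res l f) = cinner (J x) f"
  using Res_eq[OF J_in] Res_in by (simp add: shifted_eq cinner_add_right cinner_scaleC_right)

text \<open>Coercivity at \<open>y - z\<close>. Linearity of \<open>Res\<close> is deduced from
  this.\<close>

lemma shifted_cancel:
  assumes y: "y \<in> Da" and z: "z \<in> Da" and eq: "\<And>x. x \<in> Da \<Longrightarrow> shifted l x y = shifted l x z"
  shows "y = z"
proof -
  have yz: "y - z \<in> Da" using y z in_D by blast
  have "Re (shifted l (y - z) (y - z)) = 0"
    using bilinear_on_diff_right[OF sesquilinear_form_imp_bilinear_on[OF sesquilinear_shifted] yz y z]
      eq[OF yz] by simp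
  then have "(1 - \<bar>l\<bar> / \<alpha>) * Re (a (y - z) (y - z)) \<le> 0"
    using shifted_coercive[OF yz, of l] by simp
  then have "Re (a (y - z) (y - z)) \<le> 0"
    using coercivity_pos by (simp add: mult_le_0_iff del: diff_gt_0_iff_gt)
  then have "y - z = 0" by (rule eq_zero[OF yz])
  then show ?thesis by simp
qed

lemma Res_eqI:
  assumes y: "y \<in> Da" and "\<And>x. x \<in> Da \<Longrightarrow> b x y = cinner x (f + complex_of_real l *\<^sub>C y)"
  shows "Res l f = y"
proof (rule shifted_cancel[OF Res_in y])
  show "shifted l x (Res l f) = shifted l x y" if x: "x \<in> Da" for x
    unfolding shifted_Res[OF x] shifted_eq[OF x y] assms(2)[OF J_in[OF x]]
    by (simp add: cinner_add_right cinner_scaleC_right)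
qed

lemma Res_add: "Res l (f + g) = Res l f + Res l g"
proof (rule shifted_cancel[OF Res_in])
  show "Res l f + Res l g \<in> Da" using Res_in in_D by blast
  show "shifted l x (Res l (f + g)) = shifted l x (Res l f + Res l g)" if "x \<in> Da" for x
    using sesquilinear_shifted[of l] that Res_in unfolding sesquilinear_form_def
    by (simp add: shifted_Res cinner_add_right)
qed

lemma Res_scaleC: "Res l (c *\<^sub>C f) = c *\<^sub>C Res l f"
proof (rule shifted_cancel[OF Res_in])
  show "c *\<^sub>C Res l f \<in> Da" using Res_in scaleC_in by blast
  show "shifted l x (Res l (c *\<^sub>C f)) = shifted l x (c *\<^sub>C Res l f)" if "x \<in> Da" for x
    using sesquilinear_shifted[of l] that Res_in unfolding sesquilinear_form_def
    by (simp add: shifted_Res cinner_scaleC_right)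
qed

lemma Res_norm: "norm (Res l f) \<le> norm f * (1 / ((1 - \<bar>l\<bar> / \<alpha>) * \<alpha>))"
proof -
  let ?y = "Res l f" and ?m = "1 - \<bar>l\<bar> / \<alpha>"
  have m: "?m > 0" by (rule coercivity_pos)
  have "(norm (J ?y))\<^sup>2 = (norm ?y)\<^sup>2"
    unfolding norm_square_cinner[symmetric] by (simp add: cinner_J)
  then have nJ: "norm (J ?y) = norm ?y" by simp
  \<comment> \<open>Coercivity and the lower bound at the solution itself; one factor
    \<open>norm ?y\<close> is then cancelled.\<close>
  have "?m * (\<alpha> * (norm ?y)\<^sup>2) \<le> ?m * Re (a ?y ?y)"
    using m lower_bound[OF Res_in] by (intro mult_left_mono) auto
  also have "\<dots> \<le> Re (shifted l ?y ?y)" by (rule shifted_coercive[OF Res_in])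
  also have "\<dots> = inner (J ?y) f" by (simp add: shifted_Res Res_in inner_eq_Re_cinner)
  also have "\<dots> \<le> norm ?y * norm f" using norm_cauchy_schwarz[of "J ?y" f] nJ by simp
  finally have "norm ?y * (?m * \<alpha> * norm ?y) \<le> norm ?y * norm f"
    by (simp add: power2_eq_square mult_ac)
  then have "?m * \<alpha> * norm ?y \<le> norm f" by (cases "norm ?y = 0") auto
  moreover have "?m * \<alpha> > 0" using m \<alpha> by (rule mult_pos_pos)
  ultimately show ?thesis by (simp add: pos_le_divide_eq mult.commute del: diff_gt_0_iff_gt)
qed

lemma bounded_clinear_Res: "bounded_clinear (Res l)"
  unfolding bounded_clinear_def
proof (intro conjI allI)
  show "bounded_linear (Res l)"
    by (rule bounded_linear_intro[OF Res_add _ Res_norm]) (simp add: scaleR_scaleC Res_scaleC)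
qed (rule Res_scaleC)

end

section \<open>Operators associated with \<open>b\<close>: resolvent set, uniqueness,
  existence\<close>

definition represents :: "'h oper \<Rightarrow> bool" where
  "represents B \<longleftrightarrow> self_adjoint B \<and> dom B \<subseteq> Da \<and>
     (\<forall>x\<in>Da. \<forall>y\<in>dom B. b x y = cinner x (app B y))"

text \<open>By symmetry of \<open>b\<close>, the weak solution satisfies the adjoint relation
  against all of \<open>dom B\<close>, hence lies in \<open>dom B\<close>. Thus \<open>Res l\<close>
  is a right inverse of \<open>B - l\<close>.\<close>

lemma represents_Res:
  assumes B: "represents B" and l: "\<bar>l\<bar> < \<alpha>"
  shows "B (Res l f) = Some (f + complex_of_real l *\<^sub>C Res l f)"
proof -
  have "cinner (app B x) (Res l f) = cinner x (f + complex_of_real l *\<^sub>C Res l f)" if x: "x \<in> dom B" for x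
  proof -
    have xD: "x \<in> Da" using B x unfolding represents_def by blast
    have "cinner (app B x) (Res l f) = cnj (b (Res l f) x)"
      using B x Res_in[OF l, of f] cinner_commute[of "app B x"] unfolding represents_def by simp
    also have "\<dots> = b x (Res l f)" using b_commute[OF xD Res_in[OF l]] by simp
    finally show ?thesis using Res_eq[OF l xD] by simp
  qed
  then show ?thesis using B self_adjoint_eq_Some_iff unfolding represents_def by blast
qed

text \<open>The left inverse property: \<open>y\<close> itself solves the weak equation, whose
  solution is unique.\<close>

lemma Res_represents:
  assumes B: "represents B" and l: "\<bar>l\<bar> < \<alpha>" and y: "B y = Some g"
  shows "Res l (g - complex_of_real l *\<^sub>C y) = y"
proof (rule Res_eqI[OF l])
  have "y \<in> dom B" using y by blast
  then show "y \<in> Da" using B unfolding represents_def by blast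
  show "b x y = cinner x (g - complex_of_real l *\<^sub>C y + complex_of_real l *\<^sub>C y)"
    if "x \<in> Da" for x
    using B app_eq[of B y, OF y] \<open>y \<in> dom B\<close> that unfolding represents_def by auto
qed

lemma represents_imp_resolvent:
  assumes B: "represents B" and l: "\<bar>l\<bar> < \<alpha>"
  shows "boundedly_invertible (shift_operator B (complex_of_real l))"
  unfolding boundedly_invertible_def
proof (intro exI conjI allI ballI)
  let ?T = "shift_operator B (complex_of_real l)"
  show "bounded_clinear (Res l)" by (rule bounded_clinear_Res[OF l])
  fix y
  have "?T (Res l y) = Some y" using represents_Res[OF B l] by (simp add: shift_operator_def)
  then show "Res l y \<in> dom ?T" "app ?T (Res l y) = y" by (auto simp: app_def)
next
  let ?T = "shift_operator B (complex_of_real l)"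
  fix x assume "x \<in> dom ?T"
  then obtain g where g: "B x = Some g" by (auto simp: shift_operator_def)
  then show "Res l (app ?T x) = x"
    using Res_represents[OF B l g] by (simp add: shift_operator_def app_def)
qed

lemma represents_imp_boundedly_invertible:
  assumes "represents B"
  shows "boundedly_invertible B"
proof -
  have "0 *\<^sub>C x = 0" for x :: 'h using scaleR_scaleC[of 0 x] by simp
  then have "shift_operator B 0 = B"
    by (auto simp: shift_operator_def option.map_ident)
  then show ?thesis using represents_imp_resolvent[OF assms, of 0] \<alpha> by simp
qed

text \<open>Any representing operator has \<open>Res 0\<close> as its inverse, and
  \<open>Res 0\<close> is defined from \<open>b\<close> alone.\<close>

lemma represents_unique:
  assumes "represents B" "represents B'"
  shows "B = B'"
proof -
  have *: "B y = Some g \<Longrightarrow> B' y = Some g" if "represents B" "represents B'" for B B' y g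
    using Res_represents[OF that(1), of 0 y g] represents_Res[OF that(2), of 0 g] \<alpha>
      scaleR_scaleC[of 0 y] by simp
  have "B y = B' y" for y
    using *[OF assms, of y] *[OF assms(2,1), of y] by (cases "B y"; cases "B' y") auto
  then show ?thesis by (rule ext)
qed

text \<open>\<open>Res 0\<close> inherits symmetry from \<open>b\<close> and is injective because
  \<open>Da\<close> is dense, so its inverse is self-adjoint.\<close>

lemma represents_inverse_Res: "represents (inverse_operator (Res 0))"
proof -
  have l: "\<bar>0::real\<bar> < \<alpha>" using \<alpha> by simp
  have zero: "0 *\<^sub>C x = 0" for x :: 'h using scaleR_scaleC[of 0 x] by simp
  note Res_eq = Res_eq[OF l, simplified, unfolded zero, simplified]
  note Res_in = Res_in[OF l]
  have inj: "inj (Res 0)"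
  proof (rule injI)
    fix f g assume "Res 0 f = Res 0 g"
    then have "cinner x f = cinner x g" if "x \<in> Da" for x
      using Res_eq[OF that, of f] Res_eq[OF that, of g] by simp
    then show "f = g" by (rule eq_if_cinner_eq_dense[OF dense])
  qed
  have sym: "cinner (Res 0 f) g = cinner f (Res 0 g)" for f g
    using b_commute[OF Res_in Res_in, of f g] Res_eq[OF Res_in, of f g] Res_eq[OF Res_in, of g f]
      cinner_commute[of f "Res 0 g"] by simp
  let ?B = "inverse_operator (Res 0)"
  have "self_adjoint ?B"
    by (rule self_adjoint_inverse_operator[OF Res_add[OF l] Res_scaleC[OF l] sym inj])
  moreover have "y \<in> Da \<and> (\<forall>x\<in>Da. b x y = cinner x (app ?B y))" if yB: "y \<in> dom ?B" for y
  proof -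
    obtain g where g: "?B y = Some g" using yB by blast
    then have y: "Res 0 g = y" using inverse_operator_eq_Some_iff[OF inj] by blast
    show ?thesis using Res_in[of g] Res_eq[of _ g] unfolding y app_eq[of ?B y, OF g] by blast
  qed
  ultimately show ?thesis unfolding represents_def by blast
qed

end

theorem theorem2p5:
  fixes Da Dv :: "'h::complex_hilbert set"
    and a v b :: "'h form"
    and \<alpha> :: real
    and A :: "'h oper"
    and J :: "'h \<Rightarrow> 'h"
  assumes "symmetric_form Da a"
    and "closure Da = UNIV"
    and "positive_definite_form Da a"
    and "closed_form Da a"
    and "form_greatest_lower_bound Da a \<alpha>"
    and "\<alpha> > 0"
    and "symmetric_form Dv v"
    and "Da \<subseteq> Dv"
    and "relative_form_bound Da a v < \<infinity>"
    and "associated_operator Da a A"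
    and "self_adjoint_involution J"
    and "commutes_with_operator J A"
    and "\<forall>x\<in>Da. \<forall>y\<in>Da. v (J x) y = - v x (J y)"
    and "\<forall>x\<in>Da. \<forall>y\<in>Da. b x y = a x (J y) + v x y"
  shows "(\<exists>!B :: 'h oper. self_adjoint B \<and> dom B \<subseteq> Da \<and>
            (\<forall>x\<in>Da. \<forall>y\<in>dom B. b x y = cinner x (app B y))) \<and>
         (\<forall>B :: 'h oper. self_adjoint B \<and> dom B \<subseteq> Da \<and>
            (\<forall>x\<in>Da. \<forall>y\<in>dom B. b x y = cinner x (app B y)) \<longrightarrow>
            boundedly_invertible B \<and>
            complex_of_real ` {- \<alpha><..<\<alpha>} \<subseteq> resolvent_set B)"
proof -
  interpret closed_positive_form Da a \<alpha>
    using assms(1,2,4-6) unfolding form_greatest_lower_bound_def by unfold_locales auto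
  \<comment> \<open>Any finite bound will do, since the coercivity constant does not involve
    it.\<close>
  obtain n :: nat where n: "relative_form_bound Da a v < ereal (real n)"
    using less_PInf_Ex_of_nat[of "relative_form_bound Da a v"] assms(9) by auto
  \<comment> \<open>The supremum skips \<open>x = 0\<close>, which is therefore treated
    separately.\<close>
  have v_bound: "cmod (v x x) \<le> real n * Re (a x x)" if x: "x \<in> Da" for x
  proof (cases "x = 0")
    case True
    have "v x (0 *\<^sub>C x) = 0 * v x x"
      using assms(7,8) x unfolding symmetric_form_def sesquilinear_form_def by blast
    then have "v x x = 0" using True scaleR_scaleC[of 0 x] by simp
    then show ?thesis using nonneg[OF x] by simp
  next
    case False
    have "ereal (cmod (v x x) / Re (a x x)) \<le> relative_form_bound Da a v"
      unfolding relative_form_bound_def using x False by (intro SUP_upper) auto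
    then have "cmod (v x x) / Re (a x x) \<le> real n" using n
      by (metis ereal_less_eq(3) order_less_imp_le order_trans)
    then show ?thesis using pos[OF x False] by (simp add: pos_divide_le_eq)
  qed
  have v: "sesquilinear_form Da v"
  proof -
    have "sesquilinear_form Dv v" using assms(7) unfolding symmetric_form_def by blast
    then show ?thesis using subsetD[OF assms(8)] csub unfolding sesquilinear_form_def by blast
  qed
  interpret off_diagonal_perturbation Da a \<alpha> v b J "real n"
  proof
    show "v x y = cnj (v y x)" if "x \<in> Da" "y \<in> Da" for x y
      using assms(7,8) that unfolding symmetric_form_def by blast
    show "J x \<in> Da" "Re (a (J x) (J x)) = Re (a x x)" if "x \<in> Da" for x
      using commuting_involution_isometric[OF assms(10-12) that] by blast+
    show "v (J x) y = - v x (J y)" "b x y = a x (J y) + v x y" if "x \<in> Da" "y \<in> Da" for x y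
      using assms(13,14) that by blast+
  qed (fact v v_bound assms(11))+
  have "\<exists>!B. represents B"
    using represents_inverse_Res represents_unique by blast
  moreover have "complex_of_real ` {- \<alpha><..<\<alpha>} \<subseteq> resolvent_set B" if "represents B" for B
    using represents_imp_resolvent[OF that] by (auto simp: resolvent_set_def abs_less_iff)
  ultimately show ?thesis
    using represents_imp_boundedly_invertible unfolding represents_def by blast
qed

end
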